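(* For each $n\ge 1$ let $\theta_1=\theta_1^{(n)},\dots,\theta_n=\theta_n^{(n)}$ be positive real weights (allowed to depend on $n$), and set $f_n(y):=\theta_{\lfloor yn\rfloor}$ for $y\in[0,1]$. Assume that $f_n\to f$ almost everywhere on $[0,1]$ for some positive, finite, measurable function $f$ on $[0,1]$. Let $\mu$ be the law of the pair $$(X,Y):=\Big(U,\;F\big(E/f(U)\big)\Big),$$ where $U$ is a uniform random variable on $[0,1]$, $E$ is an exponential random variable of parameter $1$ independent of $U$, and $$F(x):=1-\int_0^1 e^{-x f(y)}\,dy,\qquad x\ge 0.$$ If $\sigma_n\sim \mathrm{Luce}(\theta_1,\dots,\theta_n)$ for every $n$, then the sequence $(\sigma_n)_n$ converges in probability in the permuton sense to the deterministic permuton $\mu$.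
   Context: Luce distribution: for positive reals $x_1,\dots,x_n$ with $w=x_1+\dots+x_n$ let $$p(x_1,\dots,x_n):=\frac{x_1}{w}\cdot\frac{x_2}{w-x_1}\cdot\frac{x_3}{w-x_1-x_2}\cdots\frac{x_n}{x_n}.$$ A random permutation $\sigma_n$ of $[n]=\{1,\dots,n\}$ is $\mathrm{Luce}(\theta_1,\dots,\theta_n)$-distributed if $\mathbb P(\sigma_n=\sigma)=p(\theta_{\sigma^{-1}(1)},\dots,\theta_{\sigma^{-1}(n)})$ for every $\sigma\in\mathcal S_n$, the set of permutations of $[n]$. A permuton is a Borel probability measure on $[0,1]^2$ both of whose marginals are uniform on $[0,1]$. The permuton $\mu_\sigma$ associated with $\sigma\in\mathcal S_n$ is $n$ times Lebesgue measure restricted to $\bigcup_{j=1}^n\left[\frac{j-1}{n},\frac jn\right]\times\left[\frac{\sigma(j)-1}{n},\frac{\sigma(j)}{n}\right]$. The sequence $(\sigma_n)_n$ converges in probability in the permuton sense to a deterministic permuton $\mu$ if for every continuous $g:[0,1]^2\to\mathbb R$, $\int g\,d\mu_{\sigma_n}\to\int g\,d\mu$ in probability. The value of $f_n$ on $[0,1/n)$, where $\lfloor yn\rfloor=0$, is irrelevant (e.g. set $\theta_0:=\theta_1$). *)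

theory Defs
  imports "HOL-Probability.Probability" "HOL-Combinatorics.Permutations"
begin

text \<open>
  A permutation of \<open>[n] = {1,\<dots>,n}\<close> is a function \<open>\<pi> :: nat \<Rightarrow> nat\<close> with \<open>\<pi> permutes {1..n}\<close>;
  it is the identity outside \<open>{1..n}\<close>, so \<open>inv \<pi>\<close> is the inverse permutation.
  Weight vectors are functions on \<open>nat\<close> of which only the values on \<open>{1..n}\<close> are used.
\<close>

definition luce_prob :: "nat \<Rightarrow> (nat \<Rightarrow> real) \<Rightarrow> real" where
  "luce_prob n x = (\<Prod>j=1..n. x j / ((\<Sum>i=1..n. x i) - (\<Sum>i=1..<j. x i)))"

definition luce_distributed ::
  "'w measure \<Rightarrow> nat \<Rightarrow> (nat \<Rightarrow> real) \<Rightarrow> ('w \<Rightarrow> nat \<Rightarrow> nat) \<Rightarrow> bool" where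
  "luce_distributed M n \<theta> \<sigma> \<longleftrightarrow>
     \<sigma> \<in> measurable M (count_space {\<pi>. \<pi> permutes {1..n}}) \<and>
     (\<forall>\<pi>. \<pi> permutes {1..n} \<longrightarrow>
        measure M {\<omega> \<in> space M. \<sigma> \<omega> = \<pi>} = luce_prob n (\<lambda>j. \<theta> (inv \<pi> j)))"

abbreviation unit_square :: "(real \<times> real) set" where
  "unit_square \<equiv> {0..1} \<times> {0..1}"

text \<open>
  Borel probability measures on the unit square are represented as Borel measures on the plane;
  having marginals uniform on \<open>[0,1]\<close> forces such a measure to be concentrated on the unit square.
\<close>

definition permuton :: "(real \<times> real) measure \<Rightarrow> bool" where
  "permuton \<mu> \<longleftrightarrow> prob_space \<mu> \<and> sets \<mu> = sets borel \<and>
     distr \<mu> borel fst = uniform_measure lborel {0..1} \<and>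
     distr \<mu> borel snd = uniform_measure lborel {0..1}"

definition perm_permuton :: "nat \<Rightarrow> (nat \<Rightarrow> nat) \<Rightarrow> (real \<times> real) measure" where
  "perm_permuton n \<sigma> = density lborel (\<lambda>p. ennreal (real n) *
     indicator (\<Union>j\<in>{1..n}. {(real j - 1) / real n .. real j / real n} \<times>
                            {(real (\<sigma> j) - 1) / real n .. real (\<sigma> j) / real n}) p)"

text \<open>
  Convergence in probability to a constant; the \<open>n\<close>-th variable may live on its own
  probability space \<open>P n\<close>.
\<close>

definition tendsto_in_prob ::
  "(nat \<Rightarrow> 'w measure) \<Rightarrow> (nat \<Rightarrow> 'w \<Rightarrow> real) \<Rightarrow> real \<Rightarrow> bool" where
  "tendsto_in_prob P X c \<longleftrightarrow>
     (\<forall>\<epsilon>>0. (\<lambda>n. measure (P n) {\<omega> \<in> space (P n). \<bar>X n \<omega> - c\<bar> > \<epsilon>}) \<longlonglongrightarrow> 0)"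

text \<open>
  A test function is only required to be continuous on the unit square, so its integral is
  taken over the unit square.
\<close>

definition permuton_tendsto_in_prob ::
  "(nat \<Rightarrow> 'w measure) \<Rightarrow> (nat \<Rightarrow> 'w \<Rightarrow> nat \<Rightarrow> nat) \<Rightarrow> (real \<times> real) measure \<Rightarrow> bool" where
  "permuton_tendsto_in_prob P \<sigma> \<mu> \<longleftrightarrow>
     (\<forall>g :: real \<times> real \<Rightarrow> real. continuous_on unit_square g \<longrightarrow>
        tendsto_in_prob P
          (\<lambda>n \<omega>. LINT p:unit_square|perm_permuton n (\<sigma> n \<omega>). g p)
          (LINT p:unit_square|\<mu>. g p))"

text \<open>
  The function \<open>f\<^sub>n(y) = \<theta>\<^bsub>\<lfloor>yn\<rfloor>\<^esub>\<close>; the maximum implements the convention \<open>\<theta>\<^sub>0 = \<theta>\<^sub>1\<close>.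
\<close>

definition weight_fun :: "nat \<Rightarrow> (nat \<Rightarrow> real) \<Rightarrow> real \<Rightarrow> real" where
  "weight_fun n \<theta> y = \<theta> (max 1 (nat \<lfloor>y * real n\<rfloor>))"

definition luce_F :: "(real \<Rightarrow> real) \<Rightarrow> real \<Rightarrow> real" where
  "luce_F f x = 1 - (LINT y:{0..1}|lebesgue. exp (- x * f y))"

text \<open>
  The law of \<open>(U, F(E / f(U)))\<close>, with \<open>(U, E)\<close> realised as the coordinates of a product space,
  hence independent. The first factor carries the Lebesgue sigma-algebra because \<open>f\<close> need only be
  Lebesgue measurable.
\<close>

definition luce_limit :: "(real \<Rightarrow> real) \<Rightarrow> (real \<times> real) measure" where
  "luce_limit f =
     distr (lebesgue_on {0..1} \<Otimes>\<^sub>M density lborel (\<lambda>x. ennreal (exponential_density 1 x))) borel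
       (\<lambda>(u, e). (u, luce_F f (e / f u)))"

end

theory Submission
  imports Defs
begin

text \<open>
  The proof realises the Luce distribution by exponential clocks. Let \<open>E\<^sub>1, \<dots>, E\<^sub>n\<close> be independent
  standard exponential variables and let item \<open>i\<close> ring at time \<open>T\<^sub>i = E\<^sub>i / \<theta>\<^sub>i\<close>. By the memoryless
  property each successive ring comes from a given remaining item with probability proportional to
  its weight, so the rank of \<open>T\<^sub>i\<close> among all ringing times is a Luce distributed permutation
  (\<open>measure_ring_order\<close>). Hence any bad event for \<open>\<sigma>\<^sub>n\<close> is at most as likely as a measurable event of
  clock configurations that contains every configuration ringing in a bad order
  (\<open>luce_event_le_clock_event\<close>); this comparison of probabilities replaces a coupling and never has
  to break ties.

  Everything then follows from one law of large numbers. For a bounded kernel \<open>k\<close>, Hoeffding's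
  inequality concentrates \<open>n\<^sup>-\<^sup>1 \<Sum>\<^sub>i k(i/n, T\<^sub>i)\<close> around its mean, and the mean is a step-function
  integral that converges, by dominated convergence and \<open>f\<^sub>n \<rightarrow> f\<close>, to the expectation of
  \<open>k(U, E/f(U))\<close> (\<open>clock_mean_tendsto_limit\<close>). Two kernels are used.
  With \<open>k(u, s) = 1\<^bsub>s \<le> x\<^esub>\<close> the average is the empirical distribution function \<open>G\<^sub>n(x)\<close> of the ringing
  times, and the limit is \<open>F(x)\<close>. Since \<open>F\<close> is continuous and all functions are monotone, closeness
  on a finite grid of quantiles forces uniform closeness (\<open>uniform_closeness_from_grid\<close>). The rank of
  \<open>i\<close> is \<open>n G\<^sub>n(T\<^sub>i)\<close>, so \<open>\<sigma>\<^sub>n(i)/n\<close> is uniformly close to \<open>F(T\<^sub>i)\<close>.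
  With \<open>k(u, s) = g(u, F(s))\<close> the average \<open>n\<^sup>-\<^sup>1 \<Sum>\<^sub>i g(i/n, F(T\<^sub>i))\<close> tends to \<open>\<integral> g d\<mu>\<close>, whereas by the
  previous sentence and the uniform continuity of \<open>g\<close> it differs little from
  \<open>n\<^sup>-\<^sup>1 \<Sum>\<^sub>i g(i/n, \<sigma>\<^sub>n(i)/n)\<close>, which in turn differs little from the integral of \<open>g\<close> against the
  permuton of \<open>\<sigma>\<^sub>n\<close> (\<open>set_integral_perm_permuton_approx\<close>).

  That \<open>\<mu>\<close> is a permuton is the probability integral transform: \<open>F\<close> is the continuous distribution
  function of \<open>E/f(U)\<close>, so \<open>F(E/f(U))\<close> is uniform.
\<close>

section \<open>Weighted Riemann sums\<close>

lemma prob_space_lebesgue_on_unit: "prob_space (lebesgue_on {0..1::real})"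
  by (rule prob_spaceI) (simp add: emeasure_restrict_space space_restrict_space)

lemma measurable_floor_mult:
  "(\<lambda>y. nat \<lfloor>y * real n\<rfloor>) \<in> measurable (lebesgue_on {0..1}) (count_space UNIV)"
proof -
  have "(\<lambda>y. nat \<lfloor>y * real n\<rfloor>) \<in> measurable lborel (count_space UNIV)"
    by measurable
  then show ?thesis
    by (intro measurable_restrict_space1 measurable_completion)
qed

text \<open>
  Since \<open>\<lfloor>y n\<rfloor>\<close> takes the values \<open>0, \<dots>, n - 1\<close> up to the null set \<open>{1}\<close>, the sum on the right
  starts at \<open>0\<close> and omits \<open>n\<close>.
\<close>
lemma integral_floor_step:
  fixes \<psi> :: "nat \<Rightarrow> real"
  assumes "1 \<le> n"
  shows "(LINT y|lebesgue_on {0..1}. \<psi> (nat \<lfloor>y * real n\<rfloor>)) = (\<Sum>k<n. \<psi> k) / real n"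
proof -
  interpret prob_space "lebesgue_on {0..1::real}" by (rule prob_space_lebesgue_on_unit)
  have n: "real n > 0" using assms by simp
  let ?I = "\<lambda>k. {real k / real n ..< real (Suc k) / real n}"
  have sub: "?I k \<subseteq> {0..1}" if "k < n" for k
  proof -
    have "real (Suc k) / real n \<le> 1" using that n by simp
    moreover have "0 \<le> real k / real n" by simp
    ultimately show ?thesis by (simp only: subset_iff atLeastLessThan_iff atLeastAtMost_iff) linarith
  qed
  have sets: "?I k \<in> sets (lebesgue_on {0..1})" if "k < n" for k
    using sub[OF that] by (auto simp: sets_restrict_space_iff)
  have meas: "measure (lebesgue_on {0..1}) (?I k) = 1 / real n" if "k < n" for k
    using sub[OF that] n by (simp add: measure_restrict_space field_simps)
  have ne1: "AE y in lebesgue_on {0..1}. y \<noteq> (1::real)"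
    by (subst AE_restrict_space_iff) (auto intro!: AE_I[where N="{1}"])
  have floor_iff: "nat \<lfloor>y * real n\<rfloor> = k \<longleftrightarrow> y \<in> ?I k" if "0 \<le> y" for y k
  proof -
    have "0 \<le> y * real n" using that by simp
    then have "nat \<lfloor>y * real n\<rfloor> = k \<longleftrightarrow> \<lfloor>y * real n\<rfloor> = int k" by auto
    also have "\<dots> \<longleftrightarrow> real k \<le> y * real n \<and> y * real n < real (Suc k)"
      by (auto simp: floor_eq_iff)
    also have "\<dots> \<longleftrightarrow> y \<in> ?I k" using n by (simp add: field_simps)
    finally show ?thesis .
  qed
  have "AE y in lebesgue_on {0..1}. \<psi> (nat \<lfloor>y * real n\<rfloor>) = (\<Sum>k<n. \<psi> k * indicator (?I k) y)"
    using ne1 AE_space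
  proof eventually_elim
    case (elim y)
    then have y: "0 \<le> y" "y < 1" by (auto simp: space_restrict_space)
    define m where "m = nat \<lfloor>y * real n\<rfloor>"
    have "y * real n < real n" using y n by simp
    then have mn: "m < n" using y unfolding m_def by (simp add: nat_less_iff floor_less_iff)
    have "indicator (?I k) y = (if k = m then 1 else 0 :: real)" for k
      using floor_iff[OF y(1), of k] unfolding m_def indicator_def by auto
    then have "(\<Sum>k<n. \<psi> k * indicator (?I k) y) = (\<Sum>k<n. if k = m then \<psi> k else 0)"
      by (intro sum.cong) auto
    also have "\<dots> = \<psi> m" using mn by simp
    finally show ?case by (simp add: m_def)
  qed
  then have "(LINT y|lebesgue_on {0..1}. \<psi> (nat \<lfloor>y * real n\<rfloor>)) =
      (LINT y|lebesgue_on {0..1}. (\<Sum>k<n. \<psi> k * indicator (?I k) y))"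
  proof (rule integral_cong_AE[rotated -1])
    show "(\<lambda>y. \<psi> (nat \<lfloor>y * real n\<rfloor>)) \<in> borel_measurable (lebesgue_on {0..1})"
      by (rule measurable_compose[OF measurable_floor_mult]) simp
    show "(\<lambda>y. \<Sum>k<n. \<psi> k * indicator (?I k) y) \<in> borel_measurable (lebesgue_on {0..1})"
      using sets by (intro borel_measurable_sum borel_measurable_times borel_measurable_const
        borel_measurable_indicator) auto
  qed
  also have "\<dots> = (\<Sum>k<n. LINT y|lebesgue_on {0..1}. \<psi> k * indicator (?I k) y)"
    using sets by (intro Bochner_Integration.integral_sum integrable_mult_right integrable_real_indicator)
      (auto simp: less_top[symmetric])
  also have "\<dots> = (\<Sum>k<n. \<psi> k / real n)"
  proof (intro sum.cong refl)
    fix k assume "k \<in> {..<n}"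
    then have k: "k < n" by simp
    then have "?I k \<inter> space (lebesgue_on {0..1}) = ?I k"
      using sub by (auto simp: space_restrict_space)
    then have "(LINT y|lebesgue_on {0..1}. indicator (?I k) y) = 1 / real n"
      using meas[OF k] by (simp only: Bochner_Integration.integral_indicator)
    then show "(LINT y|lebesgue_on {0..1}. \<psi> k * indicator (?I k) y) = \<psi> k / real n"
      by (simp only: integral_mult_right_zero) simp
  qed
  also have "\<dots> = (\<Sum>k<n. \<psi> k) / real n"
    by (simp add: sum_divide_distrib)
  finally show ?thesis .
qed

lemma floor_mult_divide_tendsto:
  fixes y :: real
  assumes "0 \<le> y"
  shows "(\<lambda>n. real (nat \<lfloor>y * real n\<rfloor>) / real n) \<longlonglongrightarrow> y"
proof (rule tendsto_sandwich)
  show "eventually (\<lambda>n. y - 1 / real n \<le> real (nat \<lfloor>y * real n\<rfloor>) / real n) sequentially"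
    using eventually_gt_at_top[of 0]
  proof eventually_elim
    case (elim n)
    have "y * real n - 1 \<le> real (nat \<lfloor>y * real n\<rfloor>)" using assms by linarith
    then have "(y * real n - 1) / real n \<le> real (nat \<lfloor>y * real n\<rfloor>) / real n"
      by (rule divide_right_mono) simp
    then show ?case using elim by (simp add: diff_divide_distrib)
  qed
  show "eventually (\<lambda>n. real (nat \<lfloor>y * real n\<rfloor>) / real n \<le> y) sequentially"
    using eventually_gt_at_top[of 0]
  proof eventually_elim
    case (elim n)
    have "real (nat \<lfloor>y * real n\<rfloor>) \<le> y * real n" using assms by (simp add: of_nat_nat)
    then show ?case using elim by (simp add: field_simps)
  qed
  show "(\<lambda>n. y - 1 / real n) \<longlonglongrightarrow> y"
    using tendsto_diff[OF tendsto_const[of y] lim_1_over_n] by simp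
qed simp

text \<open>
  The average is almost the integral of the step function
  \<open>y \<mapsto> \<phi> (\<lfloor>y n\<rfloor> / n) (\<theta> n \<lfloor>y n\<rfloor>)\<close>, with \<open>\<theta> n 0\<close> read as \<open>\<theta> n 1\<close>, to which dominated convergence applies. The two differ by
  an index shift: the integral sees the indices \<open>0, \<dots>, n - 1\<close> and the average sees \<open>1, \<dots>, n\<close>. As
  \<open>\<phi>\<close> is bounded, exchanging one term costs only \<open>O(1/n)\<close>.
\<close>
lemma weighted_mean_tendsto_integral:
  fixes \<phi> :: "real \<Rightarrow> real \<Rightarrow> real" and \<theta> :: "nat \<Rightarrow> nat \<Rightarrow> real"
  assumes bound: "\<And>u t. \<bar>\<phi> u t\<bar> \<le> B"
    and cont: "\<And>u t us ts. us \<longlonglongrightarrow> u \<Longrightarrow> ts \<longlonglongrightarrow> t \<Longrightarrow> 0 < t \<Longrightarrow> (\<lambda>n. \<phi> (us n) (ts n)) \<longlonglongrightarrow> \<phi> u t"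
    and meas: "(\<lambda>u. \<phi> u (f u)) \<in> borel_measurable (lebesgue_on {0..1})"
    and pos: "\<And>y. y \<in> {0..1} \<Longrightarrow> 0 < f y"
    and lim: "AE y in lebesgue_on {0..1}. (\<lambda>n. weight_fun n (\<theta> n) y) \<longlonglongrightarrow> f y"
  shows "(\<lambda>n. (\<Sum>i=1..n. \<phi> (real i / real n) (\<theta> n i)) / real n)
           \<longlonglongrightarrow> (LINT u|lebesgue_on {0..1}. \<phi> u (f u))"
proof -
  interpret prob_space "lebesgue_on {0..1::real}" by (rule prob_space_lebesgue_on_unit)
  define \<psi> where "\<psi> n k = \<phi> (real k / real n) (\<theta> n (max 1 k))" for n k
  let ?s = "\<lambda>n y. \<psi> n (nat \<lfloor>y * real n\<rfloor>)"
  have "(\<lambda>n. LINT y|lebesgue_on {0..1}. ?s n y) \<longlonglongrightarrow> (LINT u|lebesgue_on {0..1}. \<phi> u (f u))"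
  proof (rule integral_dominated_convergence[where w="\<lambda>_. B"])
    show "AE y in lebesgue_on {0..1}. (\<lambda>n. ?s n y) \<longlonglongrightarrow> \<phi> y (f y)"
      using lim AE_space
    proof eventually_elim
      case (elim y)
      then have "y \<in> {0..1}" by (simp add: space_restrict_space)
      with elim(1) have "(\<lambda>n. \<phi> (real (nat \<lfloor>y * real n\<rfloor>) / real n) (weight_fun n (\<theta> n) y)) \<longlonglongrightarrow> \<phi> y (f y)"
        by (intro cont floor_mult_divide_tendsto pos) auto
      then show ?case by (simp add: \<psi>_def weight_fun_def)
    qed
    show "?s n \<in> borel_measurable (lebesgue_on {0..1})" for n
      by (rule measurable_compose[OF measurable_floor_mult]) simp
  qed (use bound meas in \<open>auto simp: \<psi>_def\<close>)
  then have 1: "(\<lambda>n. (\<Sum>k<n. \<psi> n k) / real n) \<longlonglongrightarrow> (LINT u|lebesgue_on {0..1}. \<phi> u (f u))"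
    by (rule Lim_transform_eventually)
       (auto intro!: eventually_sequentiallyI[of 1] integral_floor_step)
  have 2: "(\<lambda>n. (\<psi> n n - \<psi> n 0) / real n) \<longlonglongrightarrow> 0"
  proof (rule Lim_null_comparison)
    show "eventually (\<lambda>n. norm ((\<psi> n n - \<psi> n 0) / real n) \<le> 2 * B / real n) sequentially"
    proof (intro always_eventually allI)
      fix n
      have "\<bar>\<psi> n n - \<psi> n 0\<bar> \<le> \<bar>\<psi> n n\<bar> + \<bar>\<psi> n 0\<bar>" by (rule abs_triangle_ineq4)
      also have "\<dots> \<le> 2 * B" using add_mono[OF bound bound] by (simp add: \<psi>_def)
      finally show "norm ((\<psi> n n - \<psi> n 0) / real n) \<le> 2 * B / real n"
        by (simp add: divide_right_mono)
    qed
    show "(\<lambda>n. 2 * B / real n) \<longlonglongrightarrow> 0"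
      using tendsto_mult[OF tendsto_const[of "2*B"] lim_1_over_n] by simp
  qed
  have "(\<lambda>n. (\<Sum>k<n. \<psi> n k) / real n + (\<psi> n n - \<psi> n 0) / real n)
          \<longlonglongrightarrow> (LINT u|lebesgue_on {0..1}. \<phi> u (f u))"
    using tendsto_add[OF 1 2] by simp
  moreover have "(\<Sum>k<n. \<psi> n k) / real n + (\<psi> n n - \<psi> n 0) / real n =
      (\<Sum>i=1..n. \<phi> (real i / real n) (\<theta> n i)) / real n" for n
  proof -
    have "(\<Sum>k<n. \<psi> n k) + \<psi> n n = (\<Sum>k=0..n. \<psi> n k)"
      by (simp add: atLeast0AtMost lessThan_Suc_atMost[symmetric])
    also have "\<dots> = \<psi> n 0 + (\<Sum>k=1..n. \<psi> n k)"
      by (simp add: sum.atLeast_Suc_atMost)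
    also have "(\<Sum>k=1..n. \<psi> n k) = (\<Sum>i=1..n. \<phi> (real i / real n) (\<theta> n i))"
      by (intro sum.cong) (auto simp: \<psi>_def max_def)
    finally show ?thesis by (simp add: add_divide_distrib[symmetric])
  qed
  ultimately show ?thesis by simp
qed

section \<open>Independent exponential clocks\<close>

definition exp1 :: "real measure" where
  "exp1 = density lborel (\<lambda>x. ennreal (exponential_density 1 x))"

lemma sets_exp1 [measurable_cong, simp]: "sets exp1 = sets borel"
  and space_exp1 [simp]: "space exp1 = UNIV"
  by (simp_all add: exp1_def)

lemma prob_space_exp1: "prob_space exp1"
  unfolding exp1_def by (rule prob_space_exponential_density) simp

lemma AE_exp1_pos: "AE x in exp1. 0 < x"
proof -
  have "AE x in lborel. x \<noteq> (0::real)" by (rule AE_lborel_singleton)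
  then show ?thesis unfolding exp1_def
    by (subst AE_density) (auto simp: exponential_density_def)
qed

lemma AE_exp1_neq: "AE x in exp1. x \<noteq> c"
  unfolding exp1_def using AE_lborel_singleton[of c] by (subst AE_density) auto

text \<open>
  In the induction for the ringing order, \<open>exp (- c x)\<close> is, up to a constant factor, the probability
  that the remaining clocks ring in the given order and after the present one, when this one shows \<open>x\<close>.
\<close>
lemma nn_integral_exp1_tail:
  assumes "0 \<le> a" "0 \<le> c"
  shows "(\<integral>\<^sup>+ x. ennreal (exp (- (c * x))) * indicator {a<..} x \<partial>exp1)
           = ennreal (exp (- ((1 + c) * a)) / (1 + c))"
proof -
  have "(\<integral>\<^sup>+ x. ennreal (exp (- (c * x))) * indicator {a<..} x \<partial>exp1) =
      (\<integral>\<^sup>+ x. ennreal (exponential_density 1 x) * (ennreal (exp (- (c * x))) * indicator {a<..} x) \<partial>lborel)"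
    unfolding exp1_def by (subst nn_integral_density) auto
  also have "\<dots> = (\<integral>\<^sup>+ x. ennreal (exp (- ((1 + c) * x))) * indicator {a..} x \<partial>lborel)"
  proof (rule nn_integral_cong_AE)
    show "AE x in lborel. ennreal (exponential_density 1 x) * (ennreal (exp (- (c * x))) * indicator {a<..} x)
        = ennreal (exp (- ((1 + c) * x))) * indicator {a..} x"
      using AE_lborel_singleton[of a]
    proof eventually_elim
      case (elim x)
      have "ennreal (exp (-x)) * ennreal (exp (- (c * x))) = ennreal (exp (- ((1 + c) * x)))"
        by (simp add: ennreal_mult'[symmetric] exp_add[symmetric] algebra_simps)
      then show ?case using elim assms(1)
        by (auto simp: exponential_density_def indicator_def)
    qed
  qed
  also have "\<dots> = ennreal (0 - exp (- ((1 + c) * a)) / (- (1 + c)))"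
  proof (rule nn_integral_FTC_atLeast)
    show "DERIV (\<lambda>x. exp (- ((1 + c) * x)) / (- (1 + c))) x :> exp (- ((1 + c) * x))" for x
    proof -
      have "DERIV (\<lambda>x. exp (- ((1 + c) * x))) x :> exp (- ((1 + c) * x)) * (- (1 + c))"
        by (rule derivative_eq_intros refl | simp)+
      from DERIV_cdivide[OF this, of "- (1 + c)"] assms show ?thesis by simp
    qed
    have "((\<lambda>x. exp (- ((1 + c) * x))) \<longlongrightarrow> 0) at_top"
      using assms
      by (intro filterlim_compose[OF exp_at_bot] filterlim_compose[OF filterlim_uminus_at_bot_at_top]
          filterlim_tendsto_pos_mult_at_top[OF tendsto_const] filterlim_ident) auto
    from tendsto_divide[OF this tendsto_const[of "- (1 + c)"]] assms
    show "((\<lambda>x. exp (- ((1 + c) * x)) / (- (1 + c))) \<longlongrightarrow> 0) at_top" by simp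
  qed auto
  also have "0 - exp (- ((1 + c) * a)) / (- (1 + c)) = exp (- ((1 + c) * a)) / (1 + c)"
    by (simp only: minus_divide_right[symmetric] diff_0 minus_minus)
  finally show ?thesis .
qed

abbreviation clocks :: "nat set \<Rightarrow> (nat \<Rightarrow> real) measure" where
  "clocks I \<equiv> PiM I (\<lambda>_. exp1)"

lemma measure_exp1_atMost:
  assumes "0 \<le> a"
  shows "measure exp1 {..a} = 1 - exp (- a)"
proof -
  interpret prob_space exp1 by (rule prob_space_exp1)
  have "emeasure exp1 {a<..} = ennreal (exp (- a))"
    using nn_integral_exp1_tail[OF assms, of 0] by simp
  then have "measure exp1 {a<..} = exp (- a)" by (simp add: measure_def)
  moreover have "UNIV - {a<..} = {..a}" by auto
  ultimately show ?thesis using prob_compl[of "{a<..}"] by simp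
qed

lemma exp1_rate_law:
  assumes "0 \<le> x" "0 < t"
  shows "(LINT e|exp1. indicator {..x} (e / t)) = 1 - exp (- x * t)"
proof -
  have "(LINT e|exp1. indicator {..x} (e / t) :: real) = (LINT e|exp1. indicator {..x * t} e)"
    using assms by (intro Bochner_Integration.integral_cong) (auto simp: indicator_def field_simps)
  also have "\<dots> = 1 - exp (- (x * t))"
    using assms by (simp add: measure_exp1_atMost)
  finally show ?thesis by simp
qed

section \<open>The ringing order of exponential clocks is Luce distributed\<close>

text \<open>
  Clocks \<open>m, \<dots>, n\<close>, listed by \<open>\<tau>\<close>, ring in this order and all after time \<open>t\<close>. The starting time \<open>t\<close>
  makes the induction work: if the first of them rings at time \<open>s\<close>, the others must
  form a chain after \<open>s\<close>, and by induction this has probability \<open>exp (- s W)\<close> times a constant, where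
  \<open>W\<close> is their total weight. Integrating over \<open>s > t\<close> against the rate \<open>\<theta> (\<tau> m)\<close> of the first clock
  gives the next Luce factor \<open>\<theta> (\<tau> m) / (\<theta> (\<tau> m) + W)\<close>.
\<close>
lemma emeasure_clock_chain:
  fixes \<theta> :: "nat \<Rightarrow> real" and \<tau> :: "nat \<Rightarrow> nat"
  assumes "m \<le> Suc n" "1 \<le> m" "0 \<le> t"
    and inj: "inj_on \<tau> {1..n}" and pos: "\<And>j. j \<in> {1..n} \<Longrightarrow> 0 < \<theta> (\<tau> j)"
  shows "emeasure (clocks (\<tau> ` {m..n}))
      {\<omega> \<in> space (clocks (\<tau> ` {m..n})). (\<forall>j\<in>{m..n}. t < \<omega> (\<tau> j) / \<theta> (\<tau> j)) \<and>
         (\<forall>j\<in>{m..n}. \<forall>k\<in>{m..n}. j < k \<longrightarrow> \<omega> (\<tau> j) / \<theta> (\<tau> j) < \<omega> (\<tau> k) / \<theta> (\<tau> k))}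
    = ennreal (exp (- t * (\<Sum>i=m..n. \<theta> (\<tau> i))) * (\<Prod>j=m..n. \<theta> (\<tau> j) / (\<Sum>i=j..n. \<theta> (\<tau> i))))"
  using assms(1-3)
proof (induction m arbitrary: t rule: inc_induct)
  case base
  interpret prob_space "clocks {}" by (intro prob_space_PiM prob_space_exp1)
  show ?case using emeasure_space_1 by simp
next
  case (step m)
  interpret product_sigma_finite "\<lambda>_::nat. exp1"
    by (intro product_sigma_finite.intro prob_space_imp_sigma_finite prob_space_exp1)
  define I where "I = \<tau> ` {Suc m..n}"
  define S where "S \<omega> j = \<omega> (\<tau> j) / \<theta> (\<tau> j)" for \<omega> :: "nat \<Rightarrow> real" and j
  define A where "A m t = {\<omega> \<in> space (clocks (\<tau> ` {m..n})). (\<forall>j\<in>{m..n}. t < S \<omega> j) \<and>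
         (\<forall>j\<in>{m..n}. \<forall>k\<in>{m..n}. j < k \<longrightarrow> S \<omega> j < S \<omega> k)}" for m t
  define W where "W = (\<Sum>i=Suc m..n. \<theta> (\<tau> i))"
  define L where "L = (\<Prod>j=Suc m..n. \<theta> (\<tau> j) / (\<Sum>i=j..n. \<theta> (\<tau> i)))"
  have mn: "1 \<le> m" "m \<le> n" "m \<in> {1..n}" using step by auto
  have W0: "0 \<le> W" unfolding W_def using mn by (intro sum_nonneg less_imp_le pos) auto
  have L0: "0 \<le> L" unfolding L_def using mn
    by (intro prod_nonneg divide_nonneg_nonneg sum_nonneg less_imp_le pos ballI) auto
  have th: "0 < \<theta> (\<tau> m)" by (rule pos) fact
  have notin: "\<tau> m \<notin> I"
  proof
    assume "\<tau> m \<in> I"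
    then obtain j where j: "j \<in> {Suc m..n}" "\<tau> m = \<tau> j" unfolding I_def by blast
    then have "m = j" using mn by (intro inj_onD[OF inj, of m j]) auto
    with j show False by simp
  qed
  have iv: "{m..n} = insert m {Suc m..n}" using mn by auto
  have ins: "\<tau> ` {m..n} = insert (\<tau> m) I"
    unfolding I_def iv by (rule image_insert)
  have fin: "finite I" by (simp add: I_def)
  have pred_Ball_finite: "{x \<in> space M. \<forall>i\<in>S. Q i x} \<in> sets M"
    if "finite S" "\<And>i. i \<in> S \<Longrightarrow> {x \<in> space M. Q i x} \<in> sets M" for M :: "(nat \<Rightarrow> real) measure" and S :: "nat set" and Q
    using that by (cases "S = {}") (auto intro: sets.sets_Collect_finite_All')
  have S_meas: "(\<lambda>\<omega>. S \<omega> j) \<in> borel_measurable (clocks (\<tau> ` {m'..n}))" if "j \<in> {m'..n}" for j m'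
    unfolding S_def using that by (intro borel_measurable_divide measurable_component_singleton[where M="\<lambda>_. exp1", simplified]) auto
  have sets_A: "A m' t \<in> sets (clocks (\<tau> ` {m'..n}))" for m' t
    unfolding A_def
    by (intro sets.sets_Collect_conj pred_Ball_finite sets.sets_Collect_imp
        sets.sets_Collect_const borel_measurable_less borel_measurable_const S_meas finite_atLeastAtMost)
  have A_sets: "A m t \<in> sets (clocks (insert (\<tau> m) I))" for t
    unfolding ins[symmetric] by (rule sets_A)
  have A'_sets: "A (Suc m) t \<in> sets (clocks I)" for t
    unfolding I_def by (rule sets_A)
  \<comment> \<open>The first clock rings at \<open>y / \<theta> (\<tau> m)\<close>, which is the new starting time for the others.\<close>
  have split: "indicator (A m t) (x(\<tau> m := y)) =
      (indicator {t * \<theta> (\<tau> m) <..} y * indicator (A (Suc m) (y / \<theta> (\<tau> m))) x :: ennreal)"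
    if x: "x \<in> space (clocks I)" for x y
  proof -
    have sp: "x(\<tau> m := y) \<in> space (clocks (\<tau> ` {m..n}))"
      using x by (auto simp: space_PiM ins PiE_def extensional_def)
    have S1: "S (x(\<tau> m := y)) m = y / \<theta> (\<tau> m)" by (simp add: S_def)
    have S2: "S (x(\<tau> m := y)) j = S x j" if "j \<in> {Suc m..n}" for j
    proof -
      have "\<tau> j \<in> I" using that by (simp add: I_def)
      with notin have "\<tau> j \<noteq> \<tau> m" by metis
      then show ?thesis by (simp add: S_def)
    qed
    have "x(\<tau> m := y) \<in> A m t \<longleftrightarrow> t < y / \<theta> (\<tau> m) \<and> (\<forall>j\<in>{Suc m..n}. y / \<theta> (\<tau> m) < S x j) \<and>
        (\<forall>j\<in>{Suc m..n}. \<forall>k\<in>{Suc m..n}. j < k \<longrightarrow> S x j < S x k)"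
      unfolding A_def using sp by (simp add: iv S1 S2) (force intro: order_less_trans)
    also have "\<dots> \<longleftrightarrow> t * \<theta> (\<tau> m) < y \<and> x \<in> A (Suc m) (y / \<theta> (\<tau> m))"
      unfolding A_def using x th by (simp add: I_def field_simps)
    finally show ?thesis by (auto simp: indicator_def)
  qed
  have "emeasure (clocks (\<tau> ` {m..n})) (A m t) = (\<integral>\<^sup>+ \<omega>. indicator (A m t) \<omega> \<partial>clocks (insert (\<tau> m) I))"
    using A_sets by (simp add: ins)
  also have "\<dots> = (\<integral>\<^sup>+ y. (\<integral>\<^sup>+ x. indicator (A m t) (x(\<tau> m := y)) \<partial>clocks I) \<partial>exp1)"
    using A_sets fin notin by (intro product_nn_integral_insert_rev) auto
  also have "\<dots> = (\<integral>\<^sup>+ y. (\<integral>\<^sup>+ x. indicator {t * \<theta> (\<tau> m) <..} y * indicator (A (Suc m) (y / \<theta> (\<tau> m))) x \<partial>clocks I) \<partial>exp1)"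
    by (intro nn_integral_cong split)
  also have "\<dots> = (\<integral>\<^sup>+ y. indicator {t * \<theta> (\<tau> m) <..} y * emeasure (clocks I) (A (Suc m) (y / \<theta> (\<tau> m))) \<partial>exp1)"
    using A'_sets by (simp add: nn_integral_cmult)
  also have "\<dots> = (\<integral>\<^sup>+ y. ennreal L * (ennreal (exp (- (W / \<theta> (\<tau> m) * y))) * indicator {t * \<theta> (\<tau> m) <..} y) \<partial>exp1)"
  proof (intro nn_integral_cong)
    fix y
    show "indicator {t * \<theta> (\<tau> m) <..} y * emeasure (clocks I) (A (Suc m) (y / \<theta> (\<tau> m))) =
       ennreal L * (ennreal (exp (- (W / \<theta> (\<tau> m) * y))) * indicator {t * \<theta> (\<tau> m) <..} y)"
    proof (cases "t * \<theta> (\<tau> m) < y")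
      case True
      have "0 \<le> t * \<theta> (\<tau> m)" using th step.prems by simp
      with True have "0 \<le> y" by linarith
      then have "emeasure (clocks I) (A (Suc m) (y / \<theta> (\<tau> m))) = ennreal (exp (- (y / \<theta> (\<tau> m)) * W) * L)"
        unfolding A_def I_def W_def L_def S_def using th by (intro step.IH) auto
      then show ?thesis using True L0 by (simp add: ennreal_mult'[symmetric] mult_ac)
    qed simp
  qed
  also have "\<dots> = ennreal L * ennreal (exp (- ((1 + W / \<theta> (\<tau> m)) * (t * \<theta> (\<tau> m)))) / (1 + W / \<theta> (\<tau> m)))"
  proof (subst nn_integral_cmult)
    have "0 \<le> t * \<theta> (\<tau> m)" "0 \<le> W / \<theta> (\<tau> m)" using th W0 step.prems by auto
    from nn_integral_exp1_tail[OF this] show "ennreal L * (\<integral>\<^sup>+ y. ennreal (exp (- (W / \<theta> (\<tau> m) * y))) * indicator {t * \<theta> (\<tau> m) <..} y \<partial>exp1)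
       = ennreal L * ennreal (exp (- ((1 + W / \<theta> (\<tau> m)) * (t * \<theta> (\<tau> m)))) / (1 + W / \<theta> (\<tau> m)))"
      by (simp only:)
  qed auto
  also have "\<dots> = ennreal (exp (- t * (\<theta> (\<tau> m) + W)) * (\<theta> (\<tau> m) / (\<theta> (\<tau> m) + W) * L))"
    using th W0 L0 by (simp add: ennreal_mult'[symmetric] field_simps)
  also have "\<theta> (\<tau> m) + W = (\<Sum>i=m..n. \<theta> (\<tau> i))"
    unfolding W_def using mn by (simp add: sum.atLeast_Suc_atMost)
  also have "\<theta> (\<tau> m) / (\<Sum>i=m..n. \<theta> (\<tau> i)) * L = (\<Prod>j=m..n. \<theta> (\<tau> j) / (\<Sum>i=j..n. \<theta> (\<tau> i)))"
    unfolding L_def using mn by (simp add: prod.atLeast_Suc_atMost)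
  finally show ?case by (simp add: A_def S_def)
qed

lemma luce_prob_tail_sums: "luce_prob n x = (\<Prod>j=1..n. x j / (\<Sum>i=j..n. x i))"
  unfolding luce_prob_def
proof (intro prod.cong refl)
  fix j assume "j \<in> {1..n}"
  then have "{1..n} = {1..<j} \<union> {j..n}" by auto
  then have "(\<Sum>i=1..n. x i) = (\<Sum>i=1..<j. x i) + (\<Sum>i=j..n. x i)"
    using sum.union_disjoint[of "{1..<j}" "{j..n}" x] by (simp add: ivl_disj_int)
  then show "x j / ((\<Sum>i=1..n. x i) - (\<Sum>i=1..<j. x i)) = x j / (\<Sum>i=j..n. x i)" by simp
qed

text \<open>
  Clock \<open>i\<close> rings as number \<open>\<pi> i\<close>. Positivity of the times excludes only a null set; it keeps all
  ringing times in the range where the limiting distribution function is monotone and continuous.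
\<close>
definition ring_order :: "nat \<Rightarrow> (nat \<Rightarrow> real) \<Rightarrow> (nat \<Rightarrow> nat) \<Rightarrow> (nat \<Rightarrow> real) set" where
  "ring_order n \<theta> \<pi> = {\<omega> \<in> space (clocks {1..n}). (\<forall>i\<in>{1..n}. 0 < \<omega> i / \<theta> i) \<and>
     (\<forall>i\<in>{1..n}. \<forall>j\<in>{1..n}. \<pi> i < \<pi> j \<longrightarrow> \<omega> i / \<theta> i < \<omega> j / \<theta> j)}"

lemma sets_ring_order [measurable]: "ring_order n \<theta> \<pi> \<in> sets (clocks {1..n})"
  unfolding ring_order_def by measurable

lemma measure_ring_order:
  assumes pos: "\<And>i. i \<in> {1..n} \<Longrightarrow> 0 < \<theta> i" and \<pi>: "\<pi> permutes {1..n}"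
  shows "measure (clocks {1..n}) (ring_order n \<theta> \<pi>) = luce_prob n (\<lambda>j. \<theta> (inv \<pi> j))"
proof -
  let ?\<tau> = "inv \<pi>"
  have \<tau>: "?\<tau> permutes {1..n}" using \<pi> by (rule permutes_inv)
  have im: "?\<tau> ` {1..n} = {1..n}" by (rule permutes_image[OF \<tau>])
  have pos': "0 < \<theta> (?\<tau> j)" if "j \<in> {1..n}" for j
    using that pos permutes_in_image[OF \<tau>] by blast
  have ball: "(\<forall>i\<in>{1..n}. Q i) \<longleftrightarrow> (\<forall>j\<in>{1..n}. Q (?\<tau> j))" for Q
    using im by (metis (no_types, lifting) imageE imageI)
  have "ring_order n \<theta> \<pi> =
     {\<omega> \<in> space (clocks {1..n}). (\<forall>j\<in>{1..n}. 0 < \<omega> (?\<tau> j) / \<theta> (?\<tau> j)) \<and>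
         (\<forall>j\<in>{1..n}. \<forall>k\<in>{1..n}. j < k \<longrightarrow> \<omega> (?\<tau> j) / \<theta> (?\<tau> j) < \<omega> (?\<tau> k) / \<theta> (?\<tau> k))}"
    unfolding ring_order_def
    by (subst (1 2 3) ball) (simp only: permutes_inverses(1)[OF \<pi>])
  then have "emeasure (clocks {1..n}) (ring_order n \<theta> \<pi>) = ennreal (luce_prob n (\<lambda>j. \<theta> (?\<tau> j)))"
    using emeasure_clock_chain[of 1 n 0 ?\<tau> \<theta>, unfolded im] pos' permutes_inj_on[OF \<tau>]
    by (simp add: luce_prob_tail_sums)
  moreover have "0 \<le> luce_prob n (\<lambda>j. \<theta> (?\<tau> j))"
    unfolding luce_prob_tail_sums
    by (intro prod_nonneg divide_nonneg_nonneg sum_nonneg less_imp_le pos' ballI) auto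
  ultimately show ?thesis by (simp add: measure_def)
qed

text \<open>
  This identity connects the permutation with the empirical distribution function of the ringing
  times: dividing by \<open>n\<close>, the rescaled rank of \<open>i\<close> is that function evaluated at the time of \<open>i\<close>.
\<close>
lemma ring_order_rank:
  assumes \<pi>: "\<pi> permutes {1..n}" and \<omega>: "\<omega> \<in> ring_order n \<theta> \<pi>" and i: "i \<in> {1..n}"
  shows "real (\<pi> i) = (\<Sum>j=1..n. indicator {..\<omega> i / \<theta> i} (\<omega> j / \<theta> j))"
proof -
  have eq: "\<omega> j / \<theta> j \<le> \<omega> i / \<theta> i \<longleftrightarrow> \<pi> j \<le> \<pi> i" if j: "j \<in> {1..n}" for j
    using \<omega> i j permutes_inj[OF \<pi>] unfolding ring_order_def
    by (smt (verit) injD linorder_not_less mem_Collect_eq nat_less_le)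
  have "(\<Sum>j=1..n. indicator {..\<omega> i / \<theta> i} (\<omega> j / \<theta> j)) = (\<Sum>j=1..n. indicator {..\<pi> i} (\<pi> j) :: real)"
    by (intro sum.cong refl) (simp add: indicator_def eq)
  also have "\<dots> = (\<Sum>k=1..n. indicator {..\<pi> i} k)"
    by (rule sum.permute[OF \<pi>, symmetric, unfolded comp_def])
  also have "\<dots> = real (card {k \<in> {1..n}. k \<le> \<pi> i})"
    by (simp add: indicator_def sum.If_cases Int_def)
  also have "{k \<in> {1..n}. k \<le> \<pi> i} = {1..\<pi> i}"
    using permutes_in_image[OF \<pi>, of i] i by auto
  finally show ?thesis by simp
qed

text \<open>
  The left-hand side is the sum of the Luce probabilities of the permutations with property \<open>Q\<close>.
  These are the probabilities of the events \<open>ring_order\<close>, which are disjoint because a clock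
  configuration determines its ranks, so the sum is the probability of a union contained in \<open>B\<close>.
\<close>
lemma luce_event_le_clock_event:
  assumes pos: "\<And>i. i \<in> {1..n} \<Longrightarrow> 0 < \<theta> i"
    and M: "prob_space M" and luce: "luce_distributed M n \<theta> \<sigma>"
    and B: "B \<in> sets (clocks {1..n})"
    and sub: "\<And>\<pi>. \<pi> permutes {1..n} \<Longrightarrow> Q \<pi> \<Longrightarrow> ring_order n \<theta> \<pi> \<subseteq> B"
  shows "measure M {\<omega> \<in> space M. Q (\<sigma> \<omega>)} \<le> measure (clocks {1..n}) B"
proof -
  interpret M: prob_space M by fact
  interpret C: prob_space "clocks {1..n}" by (intro prob_space_PiM prob_space_exp1)
  let ?R = "{\<pi>. \<pi> permutes {1..n} \<and> Q \<pi>}"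
  have meas: "\<sigma> \<in> measurable M (count_space {\<pi>. \<pi> permutes {1..n}})"
    and prob: "\<And>\<pi>. \<pi> permutes {1..n} \<Longrightarrow>
       measure M {\<omega> \<in> space M. \<sigma> \<omega> = \<pi>} = luce_prob n (\<lambda>j. \<theta> (inv \<pi> j))"
    using luce unfolding luce_distributed_def by auto
  have fin: "finite ?R" by (rule finite_subset[OF _ finite_permutations[of "{1..n}"]]) auto
  have perm: "\<sigma> \<omega> permutes {1..n}" if "\<omega> \<in> space M" for \<omega>
    using measurable_space[OF meas that] by simp
  have sets: "{\<omega> \<in> space M. \<sigma> \<omega> = \<pi>} \<in> sets M" if "\<pi> permutes {1..n}" for \<pi>
    using measurable_sets[OF meas, of "{\<pi>}"] that by (simp add: vimage_def Int_def conj_commute)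
  have "measure M {\<omega> \<in> space M. Q (\<sigma> \<omega>)} = measure M (\<Union>\<pi>\<in>?R. {\<omega> \<in> space M. \<sigma> \<omega> = \<pi>})"
    using perm by (intro arg_cong[where f="measure M"]) auto
  also have "\<dots> = (\<Sum>\<pi>\<in>?R. measure M {\<omega> \<in> space M. \<sigma> \<omega> = \<pi>})"
    using fin sets by (intro M.finite_measure_finite_Union) (auto simp: disjoint_family_on_def)
  also have "\<dots> = (\<Sum>\<pi>\<in>?R. measure (clocks {1..n}) (ring_order n \<theta> \<pi>))"
    by (intro sum.cong refl) (use prob measure_ring_order pos in auto)
  also have "\<dots> = measure (clocks {1..n}) (\<Union>\<pi>\<in>?R. ring_order n \<theta> \<pi>)"
  proof (rule C.finite_measure_finite_Union[symmetric])
    show "disjoint_family_on (ring_order n \<theta>) ?R"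
    proof (unfold disjoint_family_on_def, intro ballI impI)
      fix \<pi> \<rho> assume R: "\<pi> \<in> ?R" "\<rho> \<in> ?R" "\<pi> \<noteq> \<rho>"
      have False if "\<omega> \<in> ring_order n \<theta> \<pi>" "\<omega> \<in> ring_order n \<theta> \<rho>" for \<omega>
      proof -
        have "\<pi> i = \<rho> i" for i
        proof (cases "i \<in> {1..n}")
          case True
          then show ?thesis
            using ring_order_rank[of \<pi> n \<omega> \<theta> i] ring_order_rank[of \<rho> n \<omega> \<theta> i] R that by simp
        next
          case False
          then show ?thesis using R permutes_not_in by (metis (lifting) mem_Collect_eq)
        qed
        with R(3) show False by auto
      qed
      then show "ring_order n \<theta> \<pi> \<inter> ring_order n \<theta> \<rho> = {}" by auto
    qed
    show "ring_order n \<theta> ` ?R \<subseteq> sets (clocks {1..n})"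
      by (intro image_subsetI sets_ring_order)
  qed (use fin in auto)
  also have "\<dots> \<le> measure (clocks {1..n}) B"
    using sub B by (intro C.finite_measure_mono) auto
  finally show ?thesis .
qed

section \<open>A law of large numbers for the clocks\<close>

lemma indep_vars_PiM_coordinates:
  assumes M: "\<And>i. i \<in> I \<Longrightarrow> prob_space (M i)" and "I \<noteq> {}"
  shows "prob_space.indep_vars (PiM I M) M (\<lambda>i \<omega>. \<omega> i) I"
proof -
  interpret prob_space "PiM I M" by (intro prob_space_PiM M)
  have "distr (PiM I M) (PiM I M) (\<lambda>x. \<lambda>i\<in>I. x i) = distr (PiM I M) (PiM I M) (\<lambda>x. x)"
    by (intro distr_cong refl) (auto simp: space_PiM PiE_def extensional_restrict)
  also have "\<dots> = PiM I M" by (rule distr_id)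
  also have "\<dots> = PiM I (\<lambda>i. distr (PiM I M) (M i) (\<lambda>\<omega>. \<omega> i))"
    by (intro PiM_cong refl distr_PiM_component[symmetric] M) auto
  finally show ?thesis using assms(2)
    by (subst indep_vars_iff_distr_eq_PiM') auto
qed

text \<open>
  The summands are independent because they depend on different coordinates, and they lie in
  \<open>[-B, B]\<close>. Hence Hoeffding's inequality for their sum, at deviation \<open>n \<epsilon>\<close>, has the denominator
  \<open>n (2 B)\<^sup>2\<close>.
\<close>
lemma clock_mean_Hoeffding:
  fixes k :: "real \<Rightarrow> real \<Rightarrow> real"
  assumes "1 \<le> n" "0 < B" "0 \<le> \<epsilon>"
    and k: "\<And>u. k u \<in> borel_measurable borel" and bound: "\<And>u s. \<bar>k u s\<bar> \<le> B"
  shows "measure (clocks {1..n}) {\<omega> \<in> space (clocks {1..n}).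
      \<epsilon> \<le> \<bar>(\<Sum>i=1..n. k (real i / real n) (\<omega> i / \<theta> i)) / real n -
         (\<Sum>i=1..n. LINT e|exp1. k (real i / real n) (e / \<theta> i)) / real n\<bar>}
      \<le> 2 * exp (- (real n * (\<epsilon>\<^sup>2 / (2 * B\<^sup>2))))"
proof -
  interpret prob_space "clocks {1..n}" by (intro prob_space_PiM prob_space_exp1)
  let ?X = "\<lambda>i \<omega>. k (real i / real n) (\<omega> i / \<theta> i)"
  note k[measurable]
  have "indep_vars (\<lambda>_. borel) ?X {1..n}"
    using assms(1) by (intro indep_vars_compose2[OF indep_vars_PiM_coordinates] prob_space_exp1) auto
  then interpret H: Hoeffding_ineq "clocks {1..n}" "{1..n}" ?X "\<lambda>_. -B" "\<lambda>_. B" "\<Sum>i=1..n. expectation (?X i)"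
    using bound by unfold_locales (auto simp: abs_le_iff minus_le_iff)
  have "expectation (?X i) = (LINT e|exp1. k (real i / real n) (e / \<theta> i))" if "i \<in> {1..n}" for i
  proof -
    have "expectation (?X i) = (LINT e|distr (clocks {1..n}) exp1 (\<lambda>\<omega>. \<omega> i). k (real i / real n) (e / \<theta> i))"
      using that by (subst integral_distr) auto
    then show ?thesis using that by (subst (asm) distr_PiM_component) (auto intro: prob_space_exp1)
  qed
  then have \<mu>: "(\<Sum>i=1..n. expectation (?X i)) = (\<Sum>i=1..n. LINT e|exp1. k (real i / real n) (e / \<theta> i))"
    by (intro sum.cong) auto
  have "{\<omega> \<in> space (clocks {1..n}).
      \<epsilon> \<le> \<bar>(\<Sum>i=1..n. ?X i \<omega>) / real n - (\<Sum>i=1..n. LINT e|exp1. k (real i / real n) (e / \<theta> i)) / real n\<bar>}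
    = {\<omega> \<in> space (clocks {1..n}). \<bar>(\<Sum>i=1..n. ?X i \<omega>) - (\<Sum>i=1..n. expectation (?X i))\<bar> \<ge> real n * \<epsilon>}"
    unfolding \<mu> using assms(1) by (auto simp: diff_divide_distrib[symmetric] abs_divide field_simps)
  then show ?thesis
    using H.Hoeffding_ineq_abs_ge[of "real n * \<epsilon>"] assms(1-3)
    by (simp add: power_mult_distrib power2_eq_square field_simps)
qed

lemma clock_mean_tendsto_in_prob:
  fixes k :: "real \<Rightarrow> real \<Rightarrow> real"
  assumes "0 < \<epsilon>"
    and k: "\<And>u. k u \<in> borel_measurable borel" and bound: "\<And>u s. \<bar>k u s\<bar> \<le> B"
    and mean: "(\<lambda>n. (\<Sum>i=1..n. LINT e|exp1. k (real i / real n) (e / \<theta> n i)) / real n) \<longlonglongrightarrow> c"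
  shows "(\<lambda>n. measure (clocks {1..n}) {\<omega> \<in> space (clocks {1..n}).
      \<epsilon> < \<bar>(\<Sum>i=1..n. k (real i / real n) (\<omega> i / \<theta> n i)) / real n - c\<bar>}) \<longlonglongrightarrow> 0"
proof -
  \<comment> \<open>Hoeffding's bound needs a positive range, whereas \<open>B\<close> may be \<open>0\<close>.\<close>
  define C where "C = B + 1"
  have C: "0 < C" "\<And>u s. \<bar>k u s\<bar> \<le> C"
  proof -
    show "0 < C" using bound[of 0 0] unfolding C_def by linarith
    show "\<bar>k u s\<bar> \<le> C" for u s using bound[of u s] unfolding C_def by linarith
  qed
  note k[measurable]
  let ?m = "\<lambda>n. (\<Sum>i=1..n. LINT e|exp1. k (real i / real n) (e / \<theta> n i)) / real n"
  let ?S = "\<lambda>n \<omega>. (\<Sum>i=1..n. k (real i / real n) (\<omega> i / \<theta> n i)) / real n"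
  let ?b = "\<lambda>n::nat. 2 * exp (- (real n * ((\<epsilon>/2)\<^sup>2 / (2 * C\<^sup>2))))"
  have "eventually (\<lambda>n. \<bar>?m n - c\<bar> < \<epsilon>/2) sequentially"
    using tendstoD[OF mean, of "\<epsilon>/2"] assms(1) by (simp add: dist_real_def)
  then have ev: "eventually (\<lambda>n. norm (measure (clocks {1..n}) {\<omega> \<in> space (clocks {1..n}). \<epsilon> < \<bar>?S n \<omega> - c\<bar>}) \<le> ?b n) sequentially"
    using eventually_ge_at_top[of 1]
  proof eventually_elim
    case (elim n)
    interpret prob_space "clocks {1..n}" by (intro prob_space_PiM prob_space_exp1)
    have "measure (clocks {1..n}) {\<omega> \<in> space (clocks {1..n}). \<epsilon> < \<bar>?S n \<omega> - c\<bar>} \<le>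
        measure (clocks {1..n}) {\<omega> \<in> space (clocks {1..n}). \<epsilon>/2 \<le> \<bar>?S n \<omega> - ?m n\<bar>}"
    proof (rule finite_measure_mono)
      have "\<epsilon>/2 \<le> \<bar>s - m\<bar>" if "\<epsilon> < \<bar>s - c\<bar>" "\<bar>m - c\<bar> < \<epsilon>/2" for s m :: real
        using that by linarith
      from this[OF _ elim(1)]
      show "{\<omega> \<in> space (clocks {1..n}). \<epsilon> < \<bar>?S n \<omega> - c\<bar>} \<subseteq>
        {\<omega> \<in> space (clocks {1..n}). \<epsilon>/2 \<le> \<bar>?S n \<omega> - ?m n\<bar>}" by blast
    qed measurable
    also have "\<dots> \<le> ?b n"
      using elim C assms(1) k by (intro clock_mean_Hoeffding) auto
    finally show ?case by simp
  qed
  have "((\<lambda>x. exp (- (x * ((\<epsilon>/2)\<^sup>2 / (2 * C\<^sup>2))))) \<longlongrightarrow> 0) at_top"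
    using assms(1) C
    by (intro filterlim_compose[OF exp_at_bot] filterlim_compose[OF filterlim_uminus_at_bot_at_top]
        filterlim_at_top_mult_tendsto_pos[OF tendsto_const] filterlim_ident) auto
  from tendsto_mult[OF tendsto_const[of 2] filterlim_compose[OF this filterlim_real_sequentially]]
  have "?b \<longlonglongrightarrow> 0" by simp
  with ev show ?thesis by (rule Lim_null_comparison)
qed

section \<open>Uniform closeness of distribution functions\<close>

text \<open>
  The argument of Polya and of Glivenko and Cantelli: the points \<open>x j\<close> are the \<open>j/K\<close>-quantiles
  of \<open>F\<close>. If \<open>j/K \<le> F s < (j + 1)/K\<close>, then \<open>s\<close> lies between the quantiles numbered
  \<open>j - 1\<close> and \<open>j + 1\<close>, and monotonicity traps \<open>G s\<close> between \<open>(j - 2)/K\<close> and \<open>(j + 2)/K\<close>; where such a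
  quantile does not exist, the range \<open>[0, 1]\<close> of \<open>G\<close> takes its place. Stepping down to \<open>j - 1\<close>, not
  just to \<open>j\<close>, makes the comparison of \<open>F\<close> strict, so that \<open>F\<close> may have flat pieces.
\<close>
lemma uniform_closeness_from_grid:
  fixes F G :: "real \<Rightarrow> real" and x :: "nat \<Rightarrow> real"
  assumes K: "0 < K"
    and F: "mono_on {0..} F" "\<And>s. 0 \<le> s \<Longrightarrow> F s \<in> {0..1}"
    and G: "mono G" "\<And>s. G s \<in> {0..1}"
    and grid: "\<And>j. j \<in> {1..<K} \<Longrightarrow> 0 \<le> x j \<and> F (x j) = real j / real K"
    and close: "\<And>j. j \<in> {1..<K} \<Longrightarrow> \<bar>G (x j) - real j / real K\<bar> \<le> 1 / real K"
    and s: "0 \<le> s"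
  shows "\<bar>G s - F s\<bar> \<le> 3 / real K"
proof -
  have KK: "0 < real K" using K by simp
  define j where "j = nat \<lfloor>real K * F s\<rfloor>"
  have Fs: "0 \<le> F s" "F s \<le> 1" using F(2)[OF s] by auto
  have "0 \<le> real K * F s" using Fs by simp
  then have j: "real j \<le> real K * F s" "real K * F s < real j + 1"
    unfolding j_def by linarith+
  have jK: "real j \<le> real K" using j(1) Fs KK mult_left_le[of "F s" "real K"] by linarith
  have "real K * G s - real K * F s \<ge> - 3"
  proof (cases "j \<le> 1")
    case True
    have "0 \<le> real K * G s" using G(2)[of s] by simp
    moreover have "real j \<le> 1" using True by simp
    ultimately show ?thesis using j by linarith
  next
    case False
    then have i: "j - 1 \<in> {1..<K}" using jK by auto
    have rj: "real (j - 1) = real j - 1" using False by simp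
    have "real K * F (x (j - 1)) < real K * F s"
      using grid[OF i] KK j rj by simp
    then have "F (x (j - 1)) < F s" using KK by simp
    then have "x (j - 1) \<le> s"
      using mono_onD[OF F(1), of s "x (j - 1)"] grid[OF i] s by (cases "s \<le> x (j-1)") auto
    then have "G (x (j - 1)) \<le> G s" by (rule monoD[OF G(1)])
    then have "real K * G (x (j - 1)) \<le> real K * G s" using KK by simp
    moreover have "real K * (real (j-1) / real K - 1 / real K) \<le> real K * G (x (j - 1))"
      using close[OF i] KK by (intro mult_left_mono) (simp_all add: abs_le_iff)
    moreover have "real K * (real (j-1) / real K - 1 / real K) = real j - 2"
      using KK unfolding rj by (simp add: diff_divide_distrib[symmetric])
    ultimately show ?thesis using j by linarith
  qed
  moreover have "real K * G s - real K * F s \<le> 3"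
  proof (cases "K \<le> j + 1")
    case True
    then have "real K \<le> real j + 1" by simp
    moreover have "real K * G s \<le> real K" using G(2)[of s] KK by (simp add: mult_left_le)
    ultimately show ?thesis using j by linarith
  next
    case False
    then have i: "j + 1 \<in> {1..<K}" by auto
    have "real K * F s < real K * F (x (j + 1))"
      using grid[OF i] KK j by simp
    then have "F s < F (x (j + 1))" using KK by simp
    then have "s \<le> x (j + 1)"
      using mono_onD[OF F(1), of "x (j + 1)" s] grid[OF i] s by (cases "x (j+1) \<le> s") auto
    then have "G s \<le> G (x (j + 1))" by (rule monoD[OF G(1)])
    then have "real K * G s \<le> real K * G (x (j + 1))" using KK by simp
    moreover have "real K * G (x (j + 1)) \<le> real K * (real (j+1) / real K + 1 / real K)"
      using close[OF i] KK by (intro mult_left_mono) (simp_all add: abs_le_iff)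
    moreover have "real K * (real (j+1) / real K + 1 / real K) = real j + 2"
      using KK by (simp add: add_divide_distrib[symmetric])
    ultimately show ?thesis using j by linarith
  qed
  ultimately have "\<bar>real K * (G s - F s)\<bar> \<le> 3"
    by (simp add: right_diff_distrib abs_le_iff)
  then have "real K * \<bar>G s - F s\<bar> \<le> 3"
    by (simp add: abs_mult)
  then show ?thesis using KK by (simp add: field_simps)
qed

section \<open>Integrals against the permuton of a permutation\<close>

lemma AE_lborel_fst_notin:
  assumes "countable C"
  shows "AE p in (lborel :: (real \<times> real) measure). fst p \<notin> C"
proof -
  have [measurable]: "C \<in> sets borel" using assms by (rule sets.countable[rotated]) auto
  have "AE x in lborel. AE y in (lborel :: real measure). fst (x, y) \<notin> C"
    using AE_ball_countable[OF assms, of "\<lambda>x c. x \<noteq> c" lborel] AE_lborel_singleton by auto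
  moreover have "{p \<in> space (lborel \<Otimes>\<^sub>M lborel). fst p \<notin> C} \<in> sets (lborel \<Otimes>\<^sub>M (lborel :: real measure))"
    by measurable
  ultimately have "AE p in lborel \<Otimes>\<^sub>M (lborel :: real measure). fst p \<notin> C"
    by (intro lborel_pair.AE_pair_measure)
  then show ?thesis by (simp only: lborel_prod)
qed

definition perm_cell :: "nat \<Rightarrow> (nat \<Rightarrow> nat) \<Rightarrow> nat \<Rightarrow> (real \<times> real) set" where
  "perm_cell n \<pi> j = {(real j - 1) / real n .. real j / real n} \<times>
                     {(real (\<pi> j) - 1) / real n .. real (\<pi> j) / real n}"

lemma compact_perm_cell: "compact (perm_cell n \<pi> j)"
  unfolding perm_cell_def by (intro compact_Times compact_Icc)

lemma measure_perm_cell: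
  assumes "1 \<le> n"
  shows "measure lborel (perm_cell n \<pi> j) = 1 / (real n)\<^sup>2"
proof -
  have "emeasure lborel (perm_cell n \<pi> j) = ennreal (1 / real n) * ennreal (1 / real n)"
    unfolding perm_cell_def lborel_prod[symmetric] using assms
    by (subst lborel.emeasure_pair_measure_Times) (auto simp: divide_right_mono diff_divide_distrib[symmetric])
  then show ?thesis
    by (simp add: measure_def ennreal_mult'[symmetric] power2_eq_square)
qed

lemma perm_cell_subset:
  assumes "\<pi> permutes {1..n}" "j \<in> {1..n}"
  shows "perm_cell n \<pi> j \<subseteq> unit_square"
proof -
  have "\<pi> j \<in> {1..n}" using permutes_in_image[OF assms(1)] assms(2) by simp
  have sub: "{(real k - 1) / real n .. real k / real n} \<subseteq> {0..1}" if "k \<in> {1..n}" for k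
  proof -
    have "0 \<le> (real k - 1) / real n" "real k / real n \<le> 1" using that by auto
    then show ?thesis by auto
  qed
  show ?thesis unfolding perm_cell_def using sub[OF assms(2)] sub[OF \<open>\<pi> j \<in> {1..n}\<close>] by blast
qed

text \<open>
  The cells are closed and may share sides. Two cells belong to different columns, so they can meet
  only where the first coordinate is a multiple of \<open>1/n\<close>, which is a null set; off this set the
  indicator of the union is the sum of the indicators.
\<close>
lemma set_integral_perm_permuton:
  fixes g :: "real \<times> real \<Rightarrow> real"
  assumes n: "1 \<le> n" and \<pi>: "\<pi> permutes {1..n}" and g: "continuous_on unit_square g"
  shows "(LINT p:unit_square|perm_permuton n \<pi>. g p) =
         (\<Sum>j=1..n. real n * (LINT p:perm_cell n \<pi> j|lborel. g p))"
proof -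
  let ?U = "\<Union>j\<in>{1..n}. perm_cell n \<pi> j"
  let ?g = "\<lambda>p. indicator unit_square p *\<^sub>R g p"
  have cl: "perm_cell n \<pi> j \<in> sets borel" for j
    using compact_perm_cell by (intro borel_closed compact_imp_closed)
  have g_meas [measurable]: "?g \<in> borel_measurable borel"
    using g by (intro borel_measurable_continuous_on_indicator) (auto simp: borel_Times)
  have U [measurable]: "?U \<in> sets borel" using cl by auto
  have g_meas': "?g \<in> borel_measurable lborel" using g_meas by simp
  have U': "(\<lambda>p. real n * indicator ?U p) \<in> borel_measurable lborel" using U by simp
  have nonneg: "AE p in lborel. 0 \<le> real n * indicat_real ?U p" by simp
  have int: "integrable lborel (\<lambda>p. indicator (perm_cell n \<pi> j) p *\<^sub>R g p)" if "j \<in> {1..n}" for j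
    using borel_integrable_compact[OF compact_perm_cell continuous_on_subset[OF g perm_cell_subset[OF \<pi> that]]]
    by (simp add: indicator_def if_distrib[where f="\<lambda>x. x * _"] cong: if_cong)
  have ae: "AE p in lborel. (real n * indicator ?U p) *\<^sub>R ?g p =
      (\<Sum>j=1..n. real n * (indicator (perm_cell n \<pi> j) p *\<^sub>R g p))"
  proof -
    have "AE p in (lborel :: (real \<times> real) measure). fst p \<notin> (\<lambda>j. real j / real n) ` {1..n}"
      by (intro AE_lborel_fst_notin) auto
    then show ?thesis
    proof eventually_elim
      case (elim p)
      have lt: False if "i \<in> {1..n}" "i < j" "p \<in> perm_cell n \<pi> i" "p \<in> perm_cell n \<pi> j" for i j
      proof -
        have "fst p \<le> real i / real n" "(real j - 1) / real n \<le> fst p"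
          using that by (auto simp: perm_cell_def)
        moreover have "real i / real n \<le> (real j - 1) / real n"
          using that by (intro divide_right_mono) auto
        ultimately have "fst p = real i / real n" by linarith
        with elim that show False by blast
      qed
      show ?case
      proof (cases "p \<in> ?U")
        case False
        then show ?thesis by (auto intro!: sum.neutral[symmetric])
      next
        case True
        then obtain i where i: "i \<in> {1..n}" "p \<in> perm_cell n \<pi> i" by auto
        have "p \<notin> perm_cell n \<pi> j" if "j \<in> {1..n}" "j \<noteq> i" for j
          using lt[of i j] lt[of j i] i that by (cases i j rule: linorder_cases) blast+
        then have "(\<Sum>j=1..n. real n * (indicator (perm_cell n \<pi> j) p *\<^sub>R g p)) =
              (\<Sum>j=1..n. if j = i then real n * g p else 0)"
          using i(2) by (intro sum.cong refl) auto
        also have "\<dots> = real n * g p" using i by simp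
        finally show ?thesis using True perm_cell_subset[OF \<pi> i(1)] i(2) by (auto simp: indicator_def)
      qed
    qed
  qed
  have "perm_permuton n \<pi> = density lborel (\<lambda>p. ennreal (real n * indicator ?U p))"
    unfolding perm_permuton_def perm_cell_def[symmetric]
    by (simp add: ennreal_mult' ennreal_indicator)
  then have "(LINT p:unit_square|perm_permuton n \<pi>. g p) = (LINT p|lborel. (real n * indicator ?U p) *\<^sub>R ?g p)"
    unfolding set_lebesgue_integral_def by (simp only: integral_density[OF g_meas' U' nonneg])
  also have "\<dots> = (LINT p|lborel. (\<Sum>j=1..n. real n * (indicator (perm_cell n \<pi> j) p *\<^sub>R g p)))"
    using ae
  proof (rule integral_cong_AE[rotated -1])
    show "(\<lambda>p. (real n * indicator ?U p) *\<^sub>R ?g p) \<in> borel_measurable lborel"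
      by (rule borel_measurable_scaleR[OF U' g_meas'])
    show "(\<lambda>p. \<Sum>j=1..n. real n * (indicator (perm_cell n \<pi> j) p *\<^sub>R g p)) \<in> borel_measurable lborel"
      by (intro borel_measurable_sum borel_measurable_times borel_measurable_const borel_measurable_integrable int)
  qed
  also have "\<dots> = (\<Sum>j=1..n. real n * (LINT p:perm_cell n \<pi> j|lborel. g p))"
    using int unfolding set_lebesgue_integral_def
    by (subst Bochner_Integration.integral_sum) (auto intro!: integrable_mult_right)
  finally show ?thesis .
qed

text \<open>
  Each cell has mass \<open>1/n\<close> and side length \<open>1/n\<close>, so that replacing \<open>g\<close> on a cell by its value at the upper right
  corner is controlled by the modulus of continuity of \<open>g\<close> at scale \<open>1/n\<close>.
\<close>
lemma set_integral_perm_permuton_approx: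
  fixes g :: "real \<times> real \<Rightarrow> real"
  assumes n: "1 \<le> n" and \<pi>: "\<pi> permutes {1..n}" and g: "continuous_on unit_square g"
    and mod: "\<And>x y x' y'. x \<in> {0..1} \<Longrightarrow> y \<in> {0..1} \<Longrightarrow> x' \<in> {0..1} \<Longrightarrow> y' \<in> {0..1} \<Longrightarrow>
       \<bar>x - x'\<bar> \<le> 1 / real n \<Longrightarrow> \<bar>y - y'\<bar> \<le> 1 / real n \<Longrightarrow> \<bar>g (x, y) - g (x', y')\<bar> \<le> \<epsilon>"
  shows "\<bar>(LINT p:unit_square|perm_permuton n \<pi>. g p) -
          (\<Sum>i=1..n. g (real i / real n, real (\<pi> i) / real n)) / real n\<bar> \<le> \<epsilon>"
proof -
  let ?c = "\<lambda>j. g (real j / real n, real (\<pi> j) / real n)"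
  let ?R = "perm_cell n \<pi>"
  have n0: "0 < real n" using n by simp
  have cell: "\<bar>real n * (LINT p:?R j|lborel. g p) - ?c j / real n\<bar> \<le> \<epsilon> / real n" if j: "j \<in> {1..n}" for j
  proof -
    have sub: "?R j \<subseteq> unit_square" by (rule perm_cell_subset[OF \<pi> j])
    have int: "set_integrable lborel (?R j) g" if "continuous_on (?R j) g" for g :: "real \<times> real \<Rightarrow> real"
      using borel_integrable_compact[OF compact_perm_cell that] unfolding set_integrable_def
      by (simp add: indicator_def if_distrib[where f="\<lambda>x. x * _"] cong: if_cong)
    have gR: "continuous_on (?R j) g" by (rule continuous_on_subset[OF g sub])
    have const: "(LINT p:?R j|lborel. c) = c / (real n)\<^sup>2" for c :: real
      by (simp add: set_lebesgue_integral_def measure_perm_cell[OF n])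
    have near: "\<bar>g p - ?c j\<bar> \<le> \<epsilon>" if "p \<in> ?R j" for p
    proof -
      have "(real j / real n, real (\<pi> j) / real n) \<in> ?R j"
        using n0 by (auto simp: perm_cell_def divide_right_mono)
      then have c: "real j / real n \<in> {0..1}" "real (\<pi> j) / real n \<in> {0..1}" using sub by auto
      have "\<bar>g (fst p, snd p) - ?c j\<bar> \<le> \<epsilon>"
      proof (rule mod)
        show "fst p \<in> {0..1}" "snd p \<in> {0..1}" using sub that by auto
        show "\<bar>fst p - real j / real n\<bar> \<le> 1 / real n" "\<bar>snd p - real (\<pi> j) / real n\<bar> \<le> 1 / real n"
          using that by (auto simp: perm_cell_def diff_divide_distrib abs_le_iff)
      qed fact+
      then show ?thesis by simp
    qed
    have "(LINT p:?R j|lborel. g p) \<le> (LINT p:?R j|lborel. ?c j + \<epsilon>)"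
      using near by (intro set_integral_mono int gR continuous_on_const) (auto simp: abs_le_iff algebra_simps)
    moreover have "(LINT p:?R j|lborel. ?c j - \<epsilon>) \<le> (LINT p:?R j|lborel. g p)"
      using near by (intro set_integral_mono int gR continuous_on_const) (auto simp: abs_le_iff algebra_simps)
    ultimately have "real n * (LINT p:?R j|lborel. g p) \<le> real n * ((?c j + \<epsilon>) / (real n)\<^sup>2)"
      "real n * ((?c j - \<epsilon>) / (real n)\<^sup>2) \<le> real n * (LINT p:?R j|lborel. g p)"
      using n0 by (auto simp only: const intro!: mult_left_mono)
    moreover have "real n * (a / (real n)\<^sup>2) = a / real n" for a
      using n0 by (simp add: power2_eq_square)
    ultimately have "real n * (LINT p:?R j|lborel. g p) \<le> (?c j + \<epsilon>) / real n"
      "(?c j - \<epsilon>) / real n \<le> real n * (LINT p:?R j|lborel. g p)" by simp_all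
    then show ?thesis by (simp add: abs_le_iff add_divide_distrib diff_divide_distrib)
  qed
  have "\<bar>(LINT p:unit_square|perm_permuton n \<pi>. g p) - (\<Sum>i=1..n. ?c i) / real n\<bar> =
      \<bar>\<Sum>j=1..n. (real n * (LINT p:?R j|lborel. g p) - ?c j / real n)\<bar>"
    by (simp add: set_integral_perm_permuton[OF n \<pi> g] sum_subtractf sum_divide_distrib)
  also have "\<dots> \<le> (\<Sum>j=1..n. \<epsilon> / real n)"
    by (intro order_trans[OF sum_abs] sum_mono cell)
  also have "\<dots> = \<epsilon>" using n0 by simp
  finally show ?thesis .
qed

section \<open>The limiting distribution function\<close>

locale rate_function =
  fixes f :: "real \<Rightarrow> real"
  assumes f_meas [measurable]: "f \<in> borel_measurable (lebesgue_on {0..1})"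
    and f_pos: "\<And>y. y \<in> {0..1} \<Longrightarrow> 0 < f y"
begin

abbreviation L :: "real measure" where "L \<equiv> lebesgue_on {0..1}"

sublocale L: prob_space L by (rule prob_space_lebesgue_on_unit)
sublocale E: prob_space exp1 by (rule prob_space_exp1)
sublocale LE: pair_prob_space L exp1 ..

lemma measure_unit_L [simp]: "measure L {0..1} = 1"
  by (simp add: measure_restrict_space)

lemma f_pos_space: "u \<in> space L \<Longrightarrow> 0 < f u"
  using f_pos by (simp add: space_restrict_space)

lemma measurable_ident_L: "(\<lambda>u. u) \<in> borel_measurable L"
  by (intro measurable_restrict_space1 measurable_completion) simp

lemma measurable_fst_L: "fst \<in> borel_measurable (L \<Otimes>\<^sub>M exp1)"
  by (rule measurable_compose[OF measurable_fst measurable_ident_L])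

lemma clock_ratio_measurable: "(\<lambda>p. snd p / f (fst p)) \<in> borel_measurable (L \<Otimes>\<^sub>M exp1)"
  by measurable

lemma luce_F_eq: "luce_F f x = 1 - (LINT u|L. exp (- x * f u))"
  unfolding luce_F_def set_lebesgue_integral_def
  by (subst integral_restrict_space) (auto simp: mult_ac)

lemma luce_F_measurable [measurable]: "luce_F f \<in> borel_measurable borel"
  unfolding luce_F_eq[abs_def] by measurable

lemma integrable_exp_rate: "0 \<le> x \<Longrightarrow> integrable L (\<lambda>u. exp (- x * f u))"
  by (rule L.integrable_const_bound[where B=1])
     (auto intro!: AE_I2 simp: f_pos_space less_imp_le)

lemma luce_F_range:
  assumes "0 \<le> x"
  shows "luce_F f x \<in> {0..1}"
proof -
  have "(LINT u|L. exp (- x * f u)) \<le> (LINT u|L. 1)"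
    using assms integrable_exp_rate[OF assms]
    by (intro integral_mono) (auto simp: f_pos_space less_imp_le)
  moreover have "0 \<le> (LINT u|L. exp (- x * f u))" by (intro integral_nonneg_AE) auto
  ultimately show ?thesis by (simp add: luce_F_eq L.prob_space)
qed

lemma luce_F_mono: "mono_on {0..} (luce_F f)"
proof (rule mono_onI)
  fix x y :: real assume xy: "x \<in> {0..}" "y \<in> {0..}" "x \<le> y"
  then have "(LINT u|L. exp (- y * f u)) \<le> (LINT u|L. exp (- x * f u))"
    by (intro integral_mono integrable_exp_rate) (auto simp: f_pos_space less_imp_le intro!: mult_right_mono)
  then show "luce_F f x \<le> luce_F f y" by (simp add: luce_F_eq)
qed

lemma luce_F_0: "luce_F f 0 = 0"
  by (simp add: luce_F_eq L.prob_space)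

text \<open>
  Continuity, like monotonicity, is stated on \<open>[0, \<infinity>)\<close>: for negative \<open>x\<close> the function
  \<open>exp (- x f)\<close> can fail to be integrable, and then the integral has the default value \<open>0\<close>.
\<close>
lemma luce_F_continuous: "continuous_on {0..} (luce_F f)"
proof (rule continuous_on_sequentiallyI)
  fix xs x assume xs: "\<forall>n. xs n \<in> {0..}" and x: "x \<in> {0..}" and lim: "xs \<longlonglongrightarrow> (x::real)"
  have "(\<lambda>n. LINT u|L. exp (- xs n * f u)) \<longlonglongrightarrow> (LINT u|L. exp (- x * f u))"
  proof (rule integral_dominated_convergence[where w="\<lambda>_. 1"])
    show "AE u in L. (\<lambda>n. exp (- xs n * f u)) \<longlonglongrightarrow> exp (- x * f u)"
      using lim by (intro AE_I2 tendsto_intros)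
    show "AE u in L. norm (exp (- xs n * f u)) \<le> 1" for n
      using xs by (intro AE_I2) (auto simp: f_pos_space less_imp_le)
  qed auto
  then show "(\<lambda>n. luce_F f (xs n)) \<longlonglongrightarrow> luce_F f x"
    unfolding luce_F_eq by (intro tendsto_intros)
qed

lemma luce_F_tendsto_1: "(\<lambda>n. luce_F f (real n)) \<longlonglongrightarrow> 1"
proof -
  have "(\<lambda>n. LINT u|L. exp (- real n * f u)) \<longlonglongrightarrow> (LINT u|L. 0)"
  proof (rule integral_dominated_convergence[where w="\<lambda>_. 1"])
    show "AE u in L. (\<lambda>n. exp (- real n * f u)) \<longlonglongrightarrow> 0"
    proof (rule AE_I2)
      fix u assume "u \<in> space L"
      then have "exp (- f u) < 1" using f_pos_space by simp
      then have "(\<lambda>n. exp (- f u) ^ n) \<longlonglongrightarrow> 0" by (intro LIMSEQ_realpow_zero) auto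
      then show "(\<lambda>n. exp (- real n * f u)) \<longlonglongrightarrow> 0"
        by (simp add: exp_of_nat_mult[symmetric])
    qed
    show "AE u in L. norm (exp (- real n * f u)) \<le> 1" for n
      by (intro AE_I2) (auto simp: f_pos_space less_imp_le)
  qed auto
  then have "(\<lambda>n. 1 - (LINT u|L. exp (- real n * f u))) \<longlonglongrightarrow> 1 - 0"
    by (intro tendsto_intros) simp
  then show ?thesis by (simp add: luce_F_eq)
qed

text \<open>
  The value \<open>1\<close> is approached but not attained, because \<open>f\<close> is finite; so the quantiles exist exactly
  for \<open>a\<close> in \<open>[0, 1)\<close>.
\<close>
lemma luce_F_surj:
  assumes "0 \<le> a" "a < 1"
  obtains x where "0 \<le> x" "luce_F f x = a"
proof -
  obtain n where "a < luce_F f (real n)"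
    using order_tendstoD(1)[OF luce_F_tendsto_1 assms(2)] by (auto simp: eventually_sequentially)
  then have "\<exists>x\<ge>0. x \<le> real n \<and> luce_F f x = a"
    using assms luce_F_0 by (intro IVT' continuous_on_subset[OF luce_F_continuous]) auto
  then show ?thesis using that by blast
qed

section \<open>Limits of the clock averages\<close>

text \<open>
  The law of large numbers that carries the proof. Continuity of \<open>k\<close> is required only along
  \<open>e / t\<close> for almost every \<open>e\<close>, so that the hypothesis also covers indicators of half-lines, which jump at a single
  value of \<open>e\<close>, and kernels that are continuous only for positive times.
\<close>
lemma clock_mean_tendsto_limit:
  fixes k :: "real \<Rightarrow> real \<Rightarrow> real"
  assumes eps: "0 < \<epsilon>"
    and k: "case_prod k \<in> borel_measurable (borel \<Otimes>\<^sub>M borel)"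
    and bound: "\<And>u s. \<bar>k u s\<bar> \<le> B"
    and cont: "\<And>u t us ts. us \<longlonglongrightarrow> u \<Longrightarrow> ts \<longlonglongrightarrow> t \<Longrightarrow> 0 < t \<Longrightarrow>
        AE e in exp1. (\<lambda>n. k (us n) (e / ts n)) \<longlonglongrightarrow> k u (e / t)"
    and lim: "AE y in L. (\<lambda>n. weight_fun n (\<theta> n) y) \<longlonglongrightarrow> f y"
  shows "(\<lambda>n. measure (clocks {1..n}) {\<omega> \<in> space (clocks {1..n}).
      \<epsilon> < \<bar>(\<Sum>i=1..n. k (real i / real n) (\<omega> i / \<theta> n i)) / real n -
           (LINT u|L. LINT e|exp1. k u (e / f u))\<bar>}) \<longlonglongrightarrow> 0"
proof (rule clock_mean_tendsto_in_prob[OF eps _ bound])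
  have k': "(\<lambda>x. k (g x) (h x)) \<in> borel_measurable M"
    if "g \<in> borel_measurable M" "h \<in> borel_measurable M" for g h and M :: "'z measure"
    using measurable_compose[OF measurable_Pair[OF that] k] by simp
  show "k u \<in> borel_measurable borel" for u by (intro k') simp_all
  have km: "(\<lambda>e. k u (e / t)) \<in> borel_measurable exp1" for u t by (intro k') simp_all
  show "(\<lambda>n. (\<Sum>i=1..n. LINT e|exp1. k (real i / real n) (e / \<theta> n i)) / real n)
      \<longlonglongrightarrow> (LINT u|L. LINT e|exp1. k u (e / f u))"
  proof (rule weighted_mean_tendsto_integral[OF _ _ _ f_pos lim])
    show "\<bar>LINT e|exp1. k u (e / t)\<bar> \<le> B" for u t
    proof -
      have int: "integrable exp1 (\<lambda>e. k u (e / t))"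
        using bound by (intro E.integrable_const_bound[where B=B] km) auto
      have "\<bar>LINT e|exp1. k u (e / t)\<bar> \<le> (LINT e|exp1. \<bar>k u (e / t)\<bar>)" by (rule integral_abs_bound)
      also have "\<dots> \<le> B" using int bound by (intro E.integral_le_const) auto
      finally show ?thesis .
    qed
    show "(\<lambda>n. LINT e|exp1. k (us n) (e / ts n)) \<longlonglongrightarrow> (LINT e|exp1. k u (e / t))"
      if "us \<longlonglongrightarrow> u" "ts \<longlonglongrightarrow> t" "0 < t" for u t us ts
      by (rule integral_dominated_convergence[where w="\<lambda>_. B"]) (use cont[OF that] bound km in auto)
    have "(\<lambda>p. k (fst p) (snd p / f (fst p))) \<in> borel_measurable (L \<Otimes>\<^sub>M exp1)"
      by (intro k' measurable_fst_L clock_ratio_measurable)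
    then show "(\<lambda>u. LINT e|exp1. k u (e / f u)) \<in> borel_measurable L"
      by (intro E.borel_measurable_lebesgue_integral) (simp add: split_beta')
  qed
qed

lemma empirical_distribution_tendsto:
  assumes "0 < \<epsilon>" "0 \<le> x"
    and lim: "AE y in L. (\<lambda>n. weight_fun n (\<theta> n) y) \<longlonglongrightarrow> f y"
  shows "(\<lambda>n. measure (clocks {1..n}) {\<omega> \<in> space (clocks {1..n}).
      \<epsilon> < \<bar>(\<Sum>i=1..n. indicator {..x} (\<omega> i / \<theta> n i)) / real n - luce_F f x\<bar>}) \<longlonglongrightarrow> 0"
proof -
  let ?k = "\<lambda>(u::real) s. indicat_real {..x} s"
  have "(LINT u|L. LINT e|exp1. ?k u (e / f u)) = (LINT u|L. 1 - exp (- x * f u))"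
    using assms(2) by (intro Bochner_Integration.integral_cong refl exp1_rate_law f_pos_space)
  also have "\<dots> = luce_F f x"
    using integrable_exp_rate[OF assms(2)] by (simp add: luce_F_eq L.prob_space)
  finally have eq: "(LINT u|L. LINT e|exp1. ?k u (e / f u)) = luce_F f x" .
  show ?thesis
  proof (rule clock_mean_tendsto_limit[OF assms(1) _ _ _ lim, of ?k 1, unfolded eq])
    show "AE e in exp1. (\<lambda>n. ?k (us n) (e / ts n)) \<longlonglongrightarrow> ?k u (e / t)"
      if ts: "ts \<longlonglongrightarrow> t" and t: "0 < t" for u t :: real and us ts :: "nat \<Rightarrow> real"
      using AE_exp1_neq[of "x * t"]
    proof eventually_elim
      case (elim e)
      have l: "(\<lambda>n. e / ts n) \<longlonglongrightarrow> e / t" using ts t by (intro tendsto_intros) auto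
      have "e / t \<noteq> x" using elim t by auto
      then consider "e / t < x" | "x < e / t" by linarith
      then show ?case
      proof cases
        case 1
        then have "eventually (\<lambda>n. ?k (us n) (e / ts n) = ?k u (e / t)) sequentially"
          using order_tendstoD(2)[OF l 1] by (auto elim!: eventually_mono simp: indicator_def)
        then show ?thesis by (rule tendsto_eventually)
      next
        case 2
        then have "eventually (\<lambda>n. ?k (us n) (e / ts n) = ?k u (e / t)) sequentially"
          using order_tendstoD(1)[OF l 2] by (auto elim!: eventually_mono simp: indicator_def)
        then show ?thesis by (rule tendsto_eventually)
      qed
    qed
  qed (auto simp: indicator_def)
qed

lemma bounded_test_mean_tendsto:
  fixes h :: "real \<times> real \<Rightarrow> real"
  assumes "0 < \<epsilon>" and h: "continuous_on UNIV h" and bound: "\<And>p. \<bar>h p\<bar> \<le> B"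
    and lim: "AE y in L. (\<lambda>n. weight_fun n (\<theta> n) y) \<longlonglongrightarrow> f y"
  shows "(\<lambda>n. measure (clocks {1..n}) {\<omega> \<in> space (clocks {1..n}).
      \<epsilon> < \<bar>(\<Sum>i=1..n. h (real i / real n, luce_F f (\<omega> i / \<theta> n i))) / real n -
           (LINT u|L. LINT e|exp1. h (u, luce_F f (e / f u)))\<bar>}) \<longlonglongrightarrow> 0"
proof (rule clock_mean_tendsto_limit[OF assms(1) _ bound _ lim])
  have h' [measurable]: "h \<in> borel_measurable (borel \<Otimes>\<^sub>M borel)"
    unfolding borel_prod by (rule borel_measurable_continuous_onI[OF h])
  show "(\<lambda>(u, s). h (u, luce_F f s)) \<in> borel_measurable (borel \<Otimes>\<^sub>M borel)" by measurable
  show "AE e in exp1. (\<lambda>n. h (us n, luce_F f (e / ts n))) \<longlonglongrightarrow> h (u, luce_F f (e / t))"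
    if us: "us \<longlonglongrightarrow> u" and ts: "ts \<longlonglongrightarrow> t" and t: "0 < t" for u t us ts
    using AE_exp1_pos
  proof eventually_elim
    case (elim e)
    have l: "(\<lambda>n. e / ts n) \<longlonglongrightarrow> e / t" using ts t by (intro tendsto_intros) auto
    have "eventually (\<lambda>n. 0 < ts n) sequentially" by (rule order_tendstoD(1)[OF ts t])
    then have "eventually (\<lambda>n. e / ts n \<in> {0..}) sequentially"
      using elim by (auto elim!: eventually_mono simp: less_imp_le)
    with l have "(\<lambda>n. luce_F f (e / ts n)) \<longlonglongrightarrow> luce_F f (e / t)"
      using elim t by (intro continuous_on_tendsto_compose[OF luce_F_continuous]) auto
    then show ?case
      by (intro continuous_on_tendsto_compose[OF h] tendsto_Pair us) auto
  qed
qed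

section \<open>The limit permuton\<close>

lemma luce_limit_eq: "luce_limit f = distr (L \<Otimes>\<^sub>M exp1) borel (\<lambda>p. (fst p, luce_F f (snd p / f (fst p))))"
  unfolding luce_limit_def exp1_def[symmetric] by (simp add: split_beta')

lemma limit_point_measurable:
  "(\<lambda>p. (fst p, luce_F f (snd p / f (fst p)))) \<in> borel_measurable (L \<Otimes>\<^sub>M exp1)"
  unfolding borel_prod[symmetric]
  by (intro measurable_Pair measurable_fst_L measurable_compose[OF clock_ratio_measurable luce_F_measurable])

text \<open>
  Conditionally on \<open>U = u\<close> the time \<open>E / f(u)\<close> is exponential with rate \<open>f(u)\<close>; averaging over \<open>u\<close>
  turns its distribution function into \<open>F\<close>.
\<close>
lemma prob_clock_ratio_le:
  assumes "0 \<le> x"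
  shows "measure (L \<Otimes>\<^sub>M exp1) {p \<in> space (L \<Otimes>\<^sub>M exp1). snd p / f (fst p) \<le> x} = luce_F f x"
proof -
  note clock_ratio_measurable [measurable]
  let ?A = "{p \<in> space (L \<Otimes>\<^sub>M exp1). snd p / f (fst p) \<le> x}"
  have A: "?A \<in> sets (L \<Otimes>\<^sub>M exp1)" by measurable
  have int: "integrable (L \<Otimes>\<^sub>M exp1) (indicat_real ?A)"
    using A by (simp add: LE.emeasure_eq_measure)
  have "measure (L \<Otimes>\<^sub>M exp1) ?A = (LINT p|(L \<Otimes>\<^sub>M exp1). indicator ?A p)" using A by simp
  also have "\<dots> = (LINT u|L. LINT e|exp1. indicator ?A (u, e))"
    by (rule LE.integral_fst'[OF int, symmetric])
  also have "\<dots> = (LINT u|L. 1 - exp (- x * f u))"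
  proof (intro Bochner_Integration.integral_cong refl)
    fix u assume u: "u \<in> space L"
    have "(LINT e|exp1. indicator ?A (u, e)) = (LINT e|exp1. indicat_real {..x} (e / f u))"
      using u by (intro Bochner_Integration.integral_cong refl)
        (auto simp: indicator_def space_pair_measure)
    then show "(LINT e|exp1. indicator ?A (u, e)) = 1 - exp (- x * f u)"
      using exp1_rate_law[OF assms f_pos_space[OF u]] by simp
  qed
  also have "\<dots> = luce_F f x"
    using integrable_exp_rate[OF assms] by (simp add: luce_F_eq L.prob_space)
  finally show ?thesis .
qed

lemma AE_clock_ratio_pos: "AE p in L \<Otimes>\<^sub>M exp1. 0 < snd p / f (fst p)"
proof -
  note clock_ratio_measurable [measurable]
  have "{p \<in> space (L \<Otimes>\<^sub>M exp1). snd p / f (fst p) \<le> 0} \<in> sets (L \<Otimes>\<^sub>M exp1)" by measurable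
  then show ?thesis
  proof (rule AE_I[rotated 2])
    show "emeasure (L \<Otimes>\<^sub>M exp1) {p \<in> space (L \<Otimes>\<^sub>M exp1). snd p / f (fst p) \<le> 0} = 0"
      unfolding LE.emeasure_eq_measure prob_clock_ratio_le[OF order_refl] by (simp add: luce_F_0)
  qed (auto simp: not_less)
qed

text \<open>
  The probability integral transform. For \<open>0 \<le> a < 1\<close> the lower bound comes from a point \<open>x\<close> with
  \<open>F x = a\<close>. For the upper bound a point with \<open>F x = b\<close> is chosen for every \<open>b > a\<close>, and then \<open>b\<close>
  tends to \<open>a\<close>: beyond \<open>x\<close> the function \<open>F\<close> is at least \<open>b\<close>, hence strictly larger than \<open>a\<close>.
\<close>
lemma prob_luce_F_clock_ratio_le:
  "measure (L \<Otimes>\<^sub>M exp1) {p \<in> space (L \<Otimes>\<^sub>M exp1). luce_F f (snd p / f (fst p)) \<le> a} = min 1 (max 0 a)"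
proof -
  note clock_ratio_measurable [measurable]
  let ?S = "\<lambda>p. snd p / f (fst p)"
  let ?Q = "measure (L \<Otimes>\<^sub>M exp1)"
  let ?p = "\<lambda>a. ?Q {p \<in> space (L \<Otimes>\<^sub>M exp1). luce_F f (?S p) \<le> a}"
  have low: "a \<le> ?p a" if a: "0 \<le> a" "a < 1" for a
  proof -
    obtain x where x: "0 \<le> x" "luce_F f x = a" using luce_F_surj[OF a] by blast
    have "a = ?Q {p \<in> space (L \<Otimes>\<^sub>M exp1). ?S p \<le> x}"
      using prob_clock_ratio_le[OF x(1)] x(2) by simp
    also have "\<dots> \<le> ?p a"
    proof (rule LE.finite_measure_mono_AE)
      show "AE p in L \<Otimes>\<^sub>M exp1. p \<in> {p \<in> space (L \<Otimes>\<^sub>M exp1). ?S p \<le> x} \<longrightarrow>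
          p \<in> {p \<in> space (L \<Otimes>\<^sub>M exp1). luce_F f (?S p) \<le> a}"
        using AE_clock_ratio_pos
      proof eventually_elim
        case (elim p)
        then show ?case using mono_onD[OF luce_F_mono, of "?S p" x] x by auto
      qed
    qed measurable
    finally show ?thesis .
  qed
  have up: "?p a \<le> b" if ab: "a < b" "0 \<le> b" "b < 1" for a b
  proof -
    obtain x where x: "0 \<le> x" "luce_F f x = b" using luce_F_surj[OF ab(2,3)] by blast
    have "?p a \<le> ?Q {p \<in> space (L \<Otimes>\<^sub>M exp1). ?S p \<le> x}"
    proof (rule LE.finite_measure_mono)
      have "luce_F f x \<le> luce_F f s" if "x < s" for s
        using mono_onD[OF luce_F_mono, of x s] x that by auto
      then show "{p \<in> space (L \<Otimes>\<^sub>M exp1). luce_F f (?S p) \<le> a} \<subseteq> {p \<in> space (L \<Otimes>\<^sub>M exp1). ?S p \<le> x}"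
        using x ab(1) by (force simp: not_le[symmetric])
    qed measurable
    then show ?thesis using prob_clock_ratio_le[OF x(1)] x(2) by simp
  qed
  consider "a < 0" | "0 \<le> a" "a < 1" | "1 \<le> a" by linarith
  then show ?thesis
  proof cases
    case 1
    then have "?p a \<le> 0" using up[of a 0] by simp
    then show ?thesis using 1 measure_nonneg[of "L \<Otimes>\<^sub>M exp1"] by (simp add: order.antisym)
  next
    case 2
    have "?p a \<le> a"
    proof (rule dense_ge_bounded[OF 2(2)])
      show "?p a \<le> b" if "a < b" "b < 1" for b using up[of a b] that 2 by simp
    qed
    then show ?thesis using low[OF 2] 2 by simp
  next
    case 3
    have "AE p in L \<Otimes>\<^sub>M exp1. luce_F f (?S p) \<le> a"
      using AE_clock_ratio_pos
    proof eventually_elim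
      case (elim p)
      then show ?case using luce_F_range[of "?S p"] 3 by auto
    qed
    moreover have "{p \<in> space (L \<Otimes>\<^sub>M exp1). luce_F f (?S p) \<le> a} \<in> sets (L \<Otimes>\<^sub>M exp1)"
      by measurable
    ultimately have "?p a = 1" by (simp only: LE.prob_Collect_eq_1)
    then show ?thesis using 3 by simp
  qed
qed

lemma permuton_luce_limit: "permuton (luce_limit f)"
proof -
  note limit_point_measurable [measurable]
  have prob: "prob_space (luce_limit f)"
    unfolding luce_limit_eq by (rule LE.prob_space_distr) measurable
  have fst_b: "(fst :: real \<times> real \<Rightarrow> real) \<in> borel_measurable borel"
    and snd_b: "(snd :: real \<times> real \<Rightarrow> real) \<in> borel_measurable borel"
    by (intro borel_measurable_continuous_onI continuous_intros)+
  have uniform_prob: "prob_space (uniform_measure lborel {0..1::real})"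
    by (rule prob_space_uniform_measure) auto
  have fst: "distr (luce_limit f) borel fst = uniform_measure lborel {0..1}"
  proof -
    have "distr (luce_limit f) borel fst = distr (L \<Otimes>\<^sub>M exp1) borel fst"
      unfolding luce_limit_eq distr_distr[OF fst_b limit_point_measurable] by (simp add: comp_def)
    also have "\<dots> = distr (distr (L \<Otimes>\<^sub>M exp1) L fst) borel (\<lambda>u. u)"
      using measurable_ident_L by (subst distr_distr) (auto simp: comp_def)
    also have "\<dots> = distr L borel (\<lambda>u. u)"
      by (simp add: E.distr_pair_fst)
    also have "\<dots> = uniform_measure lborel {0..1}"
    proof (rule measure_eqI)
      fix A assume "A \<in> sets (distr L borel (\<lambda>u. u))"
      then have A: "A \<in> sets borel" by simp
      then have "emeasure (distr L borel (\<lambda>u. u)) A = emeasure L (A \<inter> {0..1})"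
        using measurable_ident_L by (subst emeasure_distr) (auto simp: space_restrict_space)
      also have "\<dots> = emeasure lborel ({0..1} \<inter> A)"
        using A by (subst emeasure_restrict_space) (auto simp: Int_commute)
      also have "\<dots> = emeasure (uniform_measure lborel {0..1}) A"
        using A by (subst emeasure_uniform_measure) (auto simp: divide_ennreal_def)
      finally show "emeasure (distr L borel (\<lambda>u. u)) A = emeasure (uniform_measure lborel {0..1}) A" .
    qed simp
    finally show ?thesis .
  qed
  have snd: "distr (luce_limit f) borel snd = uniform_measure lborel {0..1}"
  proof (rule cdf_unique)
    show "real_distribution (distr (luce_limit f) borel snd)"
      using snd_b by (intro prob_space.real_distribution_distr[OF prob]) (simp add: luce_limit_eq)
    show "real_distribution (uniform_measure lborel {0..1::real})"
      unfolding real_distribution_def real_distribution_axioms_def using uniform_prob by simp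
    show "cdf (distr (luce_limit f) borel snd) = cdf (uniform_measure lborel {0..1})"
    proof
      fix a :: real
      have "distr (luce_limit f) borel snd = distr (L \<Otimes>\<^sub>M exp1) borel (\<lambda>p. luce_F f (snd p / f (fst p)))"
        unfolding luce_limit_eq distr_distr[OF snd_b limit_point_measurable] by (simp add: comp_def)
      then have "cdf (distr (luce_limit f) borel snd) a =
          measure (L \<Otimes>\<^sub>M exp1) {p \<in> space (L \<Otimes>\<^sub>M exp1). luce_F f (snd p / f (fst p)) \<le> a}"
        unfolding cdf_def
        by (simp add: measure_distr[OF measurable_compose[OF clock_ratio_measurable luce_F_measurable]]
            vimage_def Int_def conj_commute)
      also have "\<dots> = min 1 (max 0 a)" by (rule prob_luce_F_clock_ratio_le)
      also have "\<dots> = cdf (uniform_measure lborel {0..1}) a"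
      proof -
        have "{0..1} \<inter> {..a} = {0..min 1 a}" by auto
        then show ?thesis unfolding cdf_def
          by (subst measure_uniform_measure) (auto simp: min_def max_def)
      qed
      finally show "cdf (distr (luce_limit f) borel snd) a = cdf (uniform_measure lborel {0..1}) a" .
    qed
  qed
  show ?thesis
    unfolding permuton_def using prob fst snd by (simp add: luce_limit_eq)
qed

text \<open>
  A test function \<open>g\<close> is continuous on the square only, so its composition with the limit pair need
  not be measurable; \<open>h\<close> is an extension of \<open>g\<close> to the plane. The pair lies in the square
  almost surely, which removes the restriction of the integral.
\<close>
lemma set_integral_luce_limit:
  fixes g h :: "real \<times> real \<Rightarrow> real"
  assumes h: "continuous_on UNIV h" and bound: "\<And>p. \<bar>h p\<bar> \<le> B"
    and eq: "\<And>p. p \<in> unit_square \<Longrightarrow> h p = g p"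
  shows "(LINT p:unit_square|luce_limit f. g p) = (LINT u|L. LINT e|exp1. h (u, luce_F f (e / f u)))"
proof -
  let ?\<Phi> = "\<lambda>p. (fst p, luce_F f (snd p / f (fst p)))"
  have h_meas: "h \<in> borel_measurable borel" by (rule borel_measurable_continuous_onI[OF h])
  have sq: "unit_square \<in> sets borel" by (simp add: borel_Times)
  have h\<Phi>: "(\<lambda>p. h (?\<Phi> p)) \<in> borel_measurable (L \<Otimes>\<^sub>M exp1)"
    by (rule measurable_compose[OF limit_point_measurable h_meas])
  have ind: "(\<lambda>p. indicator unit_square p *\<^sub>R h p) \<in> borel_measurable borel"
    using h_meas sq by (intro borel_measurable_scaleR borel_measurable_indicator)
  have "(LINT p:unit_square|luce_limit f. g p) = (LINT p|luce_limit f. indicator unit_square p *\<^sub>R h p)"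
    unfolding set_lebesgue_integral_def
    by (intro Bochner_Integration.integral_cong refl) (simp add: indicator_def eq)
  also have "\<dots> = (LINT p|(L \<Otimes>\<^sub>M exp1). indicator unit_square (?\<Phi> p) *\<^sub>R h (?\<Phi> p))"
    unfolding luce_limit_eq by (rule integral_distr[OF limit_point_measurable ind])
  also have "\<dots> = (LINT p|(L \<Otimes>\<^sub>M exp1). h (?\<Phi> p))"
  proof (rule integral_cong_AE)
    show "(\<lambda>p. indicator unit_square (?\<Phi> p) *\<^sub>R h (?\<Phi> p)) \<in> borel_measurable (L \<Otimes>\<^sub>M exp1)"
      by (rule measurable_compose[OF limit_point_measurable ind])
    show "AE p in L \<Otimes>\<^sub>M exp1. indicator unit_square (?\<Phi> p) *\<^sub>R h (?\<Phi> p) = h (?\<Phi> p)"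
      using AE_clock_ratio_pos AE_space
    proof eventually_elim
      case (elim p)
      have "fst p \<in> {0..1}" using elim(2) by (auto simp: space_pair_measure space_restrict_space)
      then have "?\<Phi> p \<in> unit_square" using luce_F_range[of "snd p / f (fst p)"] elim(1) by auto
      then show ?case by simp
    qed
  qed (rule h\<Phi>)
  also have "\<dots> = (LINT u|L. LINT e|exp1. h (?\<Phi> (u, e)))"
    using h\<Phi> bound by (intro LE.integral_fst'[symmetric] LE.P.integrable_const_bound[where B=B]) auto
  finally show ?thesis by simp
qed

section \<open>Convergence of Luce permutations\<close>

text \<open>
  The deterministic core: on the event that the empirical distribution function is accurate at the
  grid points, ranks may be replaced by \<open>F\<close> of the ringing times. One \<open>\<epsilon>\<close> pays for passing from the
  permuton to the points \<open>(i/n, \<pi>(i)/n)\<close>, the other for passing from \<open>\<pi>(i)/n\<close> to \<open>F(T\<^sub>i)\<close>.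
\<close>
lemma ring_order_test_integral_close:
  fixes g :: "real \<times> real \<Rightarrow> real"
  assumes n: "1 \<le> n" and \<pi>: "\<pi> permutes {1..n}" and \<omega>: "\<omega> \<in> ring_order n \<theta> \<pi>"
    and g: "continuous_on unit_square g"
    and mod: "\<And>x y x' y'. x \<in> {0..1} \<Longrightarrow> y \<in> {0..1} \<Longrightarrow> x' \<in> {0..1} \<Longrightarrow> y' \<in> {0..1} \<Longrightarrow>
       \<bar>x - x'\<bar> \<le> \<delta> \<Longrightarrow> \<bar>y - y'\<bar> \<le> \<delta> \<Longrightarrow> \<bar>g (x, y) - g (x', y')\<bar> \<le> \<epsilon>"
    and n\<delta>: "1 / real n \<le> \<delta>" and K: "0 < K" "3 / real K \<le> \<delta>"
    and grid: "\<And>j. j \<in> {1..<K} \<Longrightarrow> 0 \<le> x j \<and> luce_F f (x j) = real j / real K"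
    and close: "\<And>j. j \<in> {1..<K} \<Longrightarrow>
       \<bar>(\<Sum>i=1..n. indicator {..x j} (\<omega> i / \<theta> i)) / real n - real j / real K\<bar> \<le> 1 / real K"
  shows "\<bar>(LINT p:unit_square|perm_permuton n \<pi>. g p) -
          (\<Sum>i=1..n. g (real i / real n, luce_F f (\<omega> i / \<theta> i))) / real n\<bar> \<le> 2 * \<epsilon>"
proof -
  have n0: "0 < real n" using n by simp
  define G where "G s = (\<Sum>j=1..n. indicator {..s} (\<omega> j / \<theta> j)) / real n" for s
  have G_mono: "mono G"
    unfolding G_def by (intro monoI divide_right_mono sum_mono) (auto simp: indicator_def)
  have G_range: "G s \<in> {0..1}" for s
  proof -
    have "(\<Sum>j=1..n. indicator {..s} (\<omega> j / \<theta> j)) \<le> (\<Sum>j=1..n. 1 :: real)"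
      by (intro sum_mono) (auto simp: indicator_def)
    then show ?thesis unfolding G_def using n0 by (auto intro!: divide_nonneg_pos sum_nonneg)
  qed
  have unif: "\<bar>G s - luce_F f s\<bar> \<le> \<delta>" if "0 \<le> s" for s
  proof -
    have "\<bar>G s - luce_F f s\<bar> \<le> 3 / real K"
      by (rule uniform_closeness_from_grid[OF K(1) luce_F_mono luce_F_range G_mono G_range grid _ that])
        (use close in \<open>auto simp: G_def\<close>)
    then show ?thesis using K(2) by simp
  qed
  have near: "\<bar>g (real i / real n, real (\<pi> i) / real n) - g (real i / real n, luce_F f (\<omega> i / \<theta> i))\<bar> \<le> \<epsilon>"
    if i: "i \<in> {1..n}" for i
  proof (rule mod)
    have T: "0 \<le> \<omega> i / \<theta> i" using \<omega> i by (auto simp: ring_order_def less_imp_le)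
    have eq: "real (\<pi> i) / real n = G (\<omega> i / \<theta> i)"
      unfolding G_def ring_order_rank[OF \<pi> \<omega> i] ..
    show "real (\<pi> i) / real n \<in> {0..1}" unfolding eq by (rule G_range)
    show "luce_F f (\<omega> i / \<theta> i) \<in> {0..1}" by (rule luce_F_range[OF T])
    show "\<bar>real (\<pi> i) / real n - luce_F f (\<omega> i / \<theta> i)\<bar> \<le> \<delta>" unfolding eq by (rule unif[OF T])
    have "0 \<le> \<delta>" using n\<delta> n0 by (meson divide_nonneg_nonneg less_imp_le order_trans zero_le_one)
    then show "\<bar>real i / real n - real i / real n\<bar> \<le> \<delta>" by simp
    show "real i / real n \<in> {0..1}" "real i / real n \<in> {0..1}" using i n0 by auto
  qed
  let ?a = "\<Sum>i=1..n. g (real i / real n, real (\<pi> i) / real n)"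
  let ?b = "\<Sum>i=1..n. g (real i / real n, luce_F f (\<omega> i / \<theta> i))"
  have "\<bar>(LINT p:unit_square|perm_permuton n \<pi>. g p) - ?a / real n\<bar> \<le> \<epsilon>"
    by (rule set_integral_perm_permuton_approx[OF n \<pi> g]) (intro mod; use n\<delta> in simp)
  moreover have "\<bar>?a / real n - ?b / real n\<bar> \<le> \<epsilon>"
  proof -
    have "\<bar>?a - ?b\<bar> \<le> (\<Sum>i=1..n. \<epsilon>)"
      unfolding sum_subtractf[symmetric] by (intro order_trans[OF sum_abs] sum_mono near)
    then show ?thesis using n0
      by (simp add: diff_divide_distrib[symmetric] abs_divide divide_le_eq mult.commute)
  qed
  ultimately show ?thesis by linarith
qed

text \<open>
  A deviation of more than \<open>\<epsilon>\<close> forces one of finitely many bad clock events: the \<open>F\<close>-average of the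
  test function is off by \<open>\<epsilon>/4\<close>, or the empirical distribution function is off at a grid point. The
  number of grid points depends on \<open>\<epsilon>\<close> and \<open>g\<close> but not on \<open>n\<close>, so the union bound still tends to \<open>0\<close>.
\<close>
lemma permuton_tendsto_luce_limit:
  fixes P :: "nat \<Rightarrow> 'w measure"
  assumes pos: "\<And>n i. 1 \<le> n \<Longrightarrow> i \<in> {1..n} \<Longrightarrow> 0 < \<theta> n i"
    and lim: "AE y in L. (\<lambda>n. weight_fun n (\<theta> n) y) \<longlonglongrightarrow> f y"
    and P: "\<And>n. 1 \<le> n \<Longrightarrow> prob_space (P n)"
    and luce: "\<And>n. 1 \<le> n \<Longrightarrow> luce_distributed (P n) n (\<theta> n) (\<sigma> n)"
  shows "permuton_tendsto_in_prob P \<sigma> (luce_limit f)"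
  unfolding permuton_tendsto_in_prob_def tendsto_in_prob_def
proof (intro allI impI)
  fix g :: "real \<times> real \<Rightarrow> real" and \<epsilon> :: real
  assume g: "continuous_on unit_square g" and \<epsilon>: "0 < \<epsilon>"
  have compact_sq: "compact unit_square" by (intro compact_Times compact_Icc)
  have "bounded (g ` unit_square)"
    by (rule compact_imp_bounded[OF compact_continuous_image[OF g compact_sq]])
  then obtain B where B: "0 < B" "\<And>p. p \<in> unit_square \<Longrightarrow> norm (g p) \<le> B"
    unfolding bounded_pos by auto
  obtain h where h: "continuous_on UNIV h" "\<And>p. p \<in> unit_square \<Longrightarrow> h p = g p" "\<And>p. \<bar>h p\<bar> \<le> B"
    using Tietze[OF g _ less_imp_le[OF B(1)] B(2), of UNIV] compact_imp_closed[OF compact_sq]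
    by auto
  obtain d where d: "0 < d" "\<And>p q. p \<in> unit_square \<Longrightarrow> q \<in> unit_square \<Longrightarrow> dist q p < d \<Longrightarrow> dist (g q) (g p) < \<epsilon> / 4"
    using compact_uniformly_continuous[OF g compact_sq] \<epsilon>
    unfolding uniformly_continuous_on_def by (metis divide_pos_pos zero_less_numeral)
  \<comment> \<open>Coordinate distances of at most \<open>d / 3\<close> give a distance below \<open>d\<close> in the plane.\<close>
  define \<delta> where "\<delta> = d / 3"
  have \<delta>: "0 < \<delta>" using d(1) by (simp add: \<delta>_def)
  have mod: "\<bar>g (x, y) - g (x', y')\<bar> \<le> \<epsilon> / 4"
    if "x \<in> {0..1}" "y \<in> {0..1}" "x' \<in> {0..1}" "y' \<in> {0..1}" "\<bar>x - x'\<bar> \<le> \<delta>" "\<bar>y - y'\<bar> \<le> \<delta>" for x y x' y'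
  proof -
    have "dist (x, y) (x', y') \<le> \<bar>x - x'\<bar> + \<bar>y - y'\<bar>"
      unfolding dist_Pair_Pair dist_real_def using sqrt_sum_squares_le_sum_abs[of "\<bar>x - x'\<bar>" "\<bar>y - y'\<bar>"] by simp
    also have "\<dots> < d" using that(5,6) d(1) unfolding \<delta>_def by linarith
    finally show ?thesis using d(2)[of "(x', y')" "(x, y)"] that by (auto simp: dist_real_def)
  qed
  define K where "K = nat \<lceil>3 / \<delta>\<rceil> + 1"
  have K: "0 < K" "3 / real K \<le> \<delta>"
  proof -
    have "3 / \<delta> \<le> real K" unfolding K_def by linarith
    moreover have "0 < real K" by (simp add: K_def)
    ultimately show "3 / real K \<le> \<delta>" using \<delta> by (simp add: field_simps)
  qed (simp add: K_def)
  have "\<exists>x\<ge>0. luce_F f x = real j / real K" if "j \<in> {1..<K}" for j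
    using luce_F_surj[of "real j / real K"] that K(1) by (metis atLeastLessThan_iff divide_less_eq_1_pos
        divide_nonneg_nonneg of_nat_0_le_iff of_nat_0_less_iff of_nat_less_iff)
  then obtain x where x: "\<And>j. j \<in> {1..<K} \<Longrightarrow> 0 \<le> x j \<and> luce_F f (x j) = real j / real K"
    by metis
  define c where "c = (LINT p:unit_square|luce_limit f. g p)"
  have c: "c = (LINT u|L. LINT e|exp1. h (u, luce_F f (e / f u)))"
    unfolding c_def by (rule set_integral_luce_limit[OF h(1,3,2)])
  \<comment> \<open>Failures of the test average and, below, of the empirical distribution function at \<open>x j\<close>.\<close>
  define bad where "bad n = {\<omega> \<in> space (clocks {1..n}).
      \<epsilon> / 4 < \<bar>(\<Sum>i=1..n. h (real i / real n, luce_F f (\<omega> i / \<theta> n i))) / real n - c\<bar>}" for n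
  define badj where "badj n j = {\<omega> \<in> space (clocks {1..n}).
      1 / real K < \<bar>(\<Sum>i=1..n. indicator {..x j} (\<omega> i / \<theta> n i)) / real n - luce_F f (x j)\<bar>}" for n j
  have h_meas: "h \<in> borel_measurable (borel \<Otimes>\<^sub>M borel)"
    unfolding borel_prod by (rule borel_measurable_continuous_onI[OF h(1)])
  have bad_sets: "bad n \<in> sets (clocks {1..n})" for n
    unfolding bad_def using h_meas by measurable
  have badj_sets: "badj n j \<in> sets (clocks {1..n})" for n j
    unfolding badj_def by measurable
  have bad0: "(\<lambda>n. measure (clocks {1..n}) (bad n)) \<longlonglongrightarrow> 0"
    unfolding bad_def c using \<epsilon> by (intro bounded_test_mean_tendsto[OF _ h(1,3) lim]) simp
  have badj0: "(\<lambda>n. measure (clocks {1..n}) (badj n j)) \<longlonglongrightarrow> 0" if "j \<in> {1..<K}" for j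
    unfolding badj_def using x[OF that] K(1) by (intro empirical_distribution_tendsto[OF _ _ lim]) auto
  let ?\<Phi> = "\<lambda>n \<pi>. LINT p:unit_square|perm_permuton n \<pi>. g p"
  have bound: "measure (P n) {\<omega> \<in> space (P n). \<epsilon> < \<bar>?\<Phi> n (\<sigma> n \<omega>) - c\<bar>}
      \<le> measure (clocks {1..n}) (bad n) + (\<Sum>j\<in>{1..<K}. measure (clocks {1..n}) (badj n j))"
    if n: "1 \<le> n" and n\<delta>: "1 / real n \<le> \<delta>" for n
  proof -
    interpret C: prob_space "clocks {1..n}" by (intro prob_space_PiM prob_space_exp1)
    let ?B = "bad n \<union> (\<Union>j\<in>{1..<K}. badj n j)"
    have "measure (P n) {\<omega> \<in> space (P n). \<epsilon> < \<bar>?\<Phi> n (\<sigma> n \<omega>) - c\<bar>} \<le> measure (clocks {1..n}) ?B"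
    proof (rule luce_event_le_clock_event[where Q="\<lambda>\<pi>. \<epsilon> < \<bar>?\<Phi> n \<pi> - c\<bar>", OF pos[OF n] P[OF n] luce[OF n]])
      show "?B \<in> sets (clocks {1..n})" using bad_sets badj_sets by auto
      show "ring_order n (\<theta> n) \<pi> \<subseteq> ?B" if \<pi>: "\<pi> permutes {1..n}" and far: "\<epsilon> < \<bar>?\<Phi> n \<pi> - c\<bar>" for \<pi>
      proof
        fix \<omega> assume \<omega>: "\<omega> \<in> ring_order n (\<theta> n) \<pi>"
        then have sp: "\<omega> \<in> space (clocks {1..n})" by (simp add: ring_order_def)
        show "\<omega> \<in> ?B"
        proof (rule ccontr)
          assume nB: "\<omega> \<notin> ?B"
          let ?m = "\<lambda>g. (\<Sum>i=1..n. g (real i / real n, luce_F f (\<omega> i / \<theta> n i))) / real n"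
          have "\<bar>?\<Phi> n \<pi> - ?m g\<bar> \<le> 2 * (\<epsilon> / 4)"
          proof (rule ring_order_test_integral_close[OF n \<pi> \<omega> g mod n\<delta> K x])
            show "\<bar>(\<Sum>i=1..n. indicator {..x j} (\<omega> i / \<theta> n i)) / real n - real j / real K\<bar> \<le> 1 / real K"
              if j: "j \<in> {1..<K}" for j
            proof -
              have "\<omega> \<notin> badj n j" using nB j by blast
              then show ?thesis using sp x[OF j] by (auto simp: badj_def)
            qed
          qed
          moreover have "?m g = ?m h"
          proof -
            have "g (real i / real n, luce_F f (\<omega> i / \<theta> n i)) = h (real i / real n, luce_F f (\<omega> i / \<theta> n i))"
              if i: "i \<in> {1..n}" for i
            proof (rule h(2)[symmetric])
              have "0 \<le> \<omega> i / \<theta> n i" using \<omega> i by (auto simp: ring_order_def less_imp_le)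
              from luce_F_range[OF this] i show "(real i / real n, luce_F f (\<omega> i / \<theta> n i)) \<in> unit_square" by auto
            qed
            then show ?thesis by simp
          qed
          moreover have "\<bar>?m h - c\<bar> \<le> \<epsilon> / 4" using nB sp by (auto simp: bad_def)
          ultimately show False using far \<epsilon> by linarith
        qed
      qed
    qed
    also have "\<dots> \<le> measure (clocks {1..n}) (bad n) + measure (clocks {1..n}) (\<Union>j\<in>{1..<K}. badj n j)"
      using bad_sets badj_sets by (intro measure_Un_le) auto
    also have "measure (clocks {1..n}) (\<Union>j\<in>{1..<K}. badj n j) \<le> (\<Sum>j\<in>{1..<K}. measure (clocks {1..n}) (badj n j))"
      using badj_sets by (intro measure_UNION_le) auto
    finally show ?thesis by simp
  qed
  have ev: "eventually (\<lambda>n. norm (measure (P n) {\<omega> \<in> space (P n). \<epsilon> < \<bar>?\<Phi> n (\<sigma> n \<omega>) - c\<bar>})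
      \<le> measure (clocks {1..n}) (bad n) + (\<Sum>j\<in>{1..<K}. measure (clocks {1..n}) (badj n j))) sequentially"
    using eventually_ge_at_top[of 1] order_tendstoD(2)[OF lim_1_over_n \<delta>]
    by eventually_elim (use bound in \<open>simp add: less_imp_le\<close>)
  have "(\<lambda>n. measure (clocks {1..n}) (bad n) + (\<Sum>j\<in>{1..<K}. measure (clocks {1..n}) (badj n j)))
      \<longlonglongrightarrow> 0 + (\<Sum>j\<in>{1..<K}. 0)"
    by (intro tendsto_add tendsto_sum bad0 badj0)
  then have "(\<lambda>n. measure (clocks {1..n}) (bad n) + (\<Sum>j\<in>{1..<K}. measure (clocks {1..n}) (badj n j))) \<longlonglongrightarrow> 0"
    by simp
  with ev have "(\<lambda>n. measure (P n) {\<omega> \<in> space (P n). \<epsilon> < \<bar>?\<Phi> n (\<sigma> n \<omega>) - c\<bar>}) \<longlonglongrightarrow> 0"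
    by (rule Lim_null_comparison)
  then show "(\<lambda>n. measure (P n) {\<omega> \<in> space (P n). \<epsilon> < \<bar>(LINT p:unit_square|perm_permuton n (\<sigma> n \<omega>). g p) -
       (LINT p:unit_square|luce_limit f. g p)\<bar>}) \<longlonglongrightarrow> 0"
    unfolding c_def .
qed

end

theorem theorem2p1:
  fixes \<theta> :: "nat \<Rightarrow> nat \<Rightarrow> real" and f :: "real \<Rightarrow> real"
    and P :: "nat \<Rightarrow> 'w measure" and \<sigma> :: "nat \<Rightarrow> 'w \<Rightarrow> nat \<Rightarrow> nat"
  assumes "\<And>n i. 1 \<le> n \<Longrightarrow> i \<in> {1..n} \<Longrightarrow> 0 < \<theta> n i"
    and "f \<in> borel_measurable (lebesgue_on {0..1})"
    and "\<And>y. y \<in> {0..1} \<Longrightarrow> 0 < f y"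
    and "AE y in lebesgue_on {0..1}. (\<lambda>n. weight_fun n (\<theta> n) y) \<longlonglongrightarrow> f y"
    and "\<And>n. 1 \<le> n \<Longrightarrow> prob_space (P n)"
    and "\<And>n. 1 \<le> n \<Longrightarrow> luce_distributed (P n) n (\<theta> n) (\<sigma> n)"
  shows "permuton (luce_limit f) \<and> permuton_tendsto_in_prob P \<sigma> (luce_limit f)"
proof -
  interpret rate_function f using assms(2,3) by unfold_locales
  show ?thesis
    using permuton_luce_limit permuton_tendsto_luce_limit[OF assms(1,4,5,6)] by blast
qed

end
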